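(* Let $X\subseteq\mathbb{R}^n$, let $f,g_1,\dots,g_m$ be smooth vector fields on $X$, and consider any control-affine system $$\dot x=f(x)+\sum_{i=1}^m g_i(x)u_i,\qquad x\in X,\quad u=[u_1,\dots,u_m]^\top\in\mathbb{R}^m,$$ with $f(x_0)=0$. There exists a coordinate transformation $\Phi$ that transforms the system into a controllable linear system $(A,B)$ on some set $\tilde V$ containing $x_0$ if and only if the following two conditions hold on (the same set) $\tilde V$: (i) $\dim\left(\operatorname{span}\{\operatorname{ad}_f^j g_i(x) : 1\le i\le m,\ 0\le j\le n-1\}\right)$ is constant and equal to $n$ for all $x\in\tilde V$; and (ii) $[\operatorname{ad}_f^k g_i,\operatorname{ad}_f^l g_j](x)=0$ for all $1\le i,j\le m$, all $k,l\ge 0$, and all $x\in\tilde V$.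
   Context: Lie bracket convention: for vector fields $v,w$ on a subset of $\mathbb{R}^n$, $[v,w](x)=\nabla_x v(x)\cdot w(x)-\nabla_x w(x)\cdot v(x)$, where $\nabla_x$ denotes the Jacobian matrix. Repeated brackets: $\operatorname{ad}_f^0 g=g$ and $\operatorname{ad}_f^k g=[f,\operatorname{ad}_f^{k-1}g]$ for $k\ge 1$. A coordinate transformation on $\tilde V$ is a $\mathcal{C}^2$ diffeomorphism $\Phi$ from $\tilde V$ onto its image in $\mathbb{R}^n$ (the transformed state has the same dimension $n$ as the original one). It transforms the system into the linear system $(A,B)$ on $\tilde V$, with $A\in\mathbb{R}^{n\times n}$ and $B\in\mathbb{R}^{n\times m}$, if $z(t)=\Phi(x(t))$ satisfies $\frac{d}{dt}z(t)=Az(t)+Bu(t)$ for any input $u(\cdot)$, any initial state $x(0)\in\tilde V$, and $t<\inf\{\tau>0 : x(\tau)\notin\tilde V\}$ (the input $u$ is not transformed). The linear system $(A,B)$ is controllable if $[B,\,AB,\,\dots,\,A^{n-1}B]$ has rank $n$.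
   Formalization: V~ is taken to be an open neighbourhood of x0 inside X; (i),(ii) are necessary on every such V~, but sufficient on the same V~ only for V~ inside some neighbourhood of x0, since on large V~ the linearizing map may fail to be injective; existence of some V~ is also shown equivalent. *)

theory Defs
  imports "HOL-Analysis.Analysis" "HOL-Library.Extended_Real"
begin

text \<open>
  \<open>C_on k S f\<close> is only meant for open \<open>S\<close>: \<open>f\<close> is \<open>k\<close> times continuously differentiable on \<open>S\<close>.
  In finite dimension the derivative is continuous iff all directional derivatives are.
\<close>

primrec C_on :: "nat \<Rightarrow> 'a::euclidean_space set \<Rightarrow> ('a \<Rightarrow> 'b::real_normed_vector) \<Rightarrow> bool" where
  "C_on 0 S f = continuous_on S f"
| "C_on (Suc k) S f =
     ((\<forall>x\<in>S. f differentiable (at x)) \<and>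
      (\<forall>d. C_on k S (\<lambda>x. frechet_derivative f (at x) d)))"

text \<open>
  On an arbitrary set, smooth means extendable to a smooth function on an open neighbourhood of
  the set; for open \<open>S\<close> this is the usual notion.
\<close>

definition smooth_on :: "'a::euclidean_space set \<Rightarrow> ('a \<Rightarrow> 'b::real_normed_vector) \<Rightarrow> bool" where
  "smooth_on S f \<longleftrightarrow>
     (\<exists>U F. open U \<and> S \<subseteq> U \<and> (\<forall>k. C_on k U F) \<and> (\<forall>x\<in>S. f x = F x))"

text \<open>
  Sign convention: this is the negative of the more common bracket. Vector fields are total
  functions; the bracket is meaningful at interior points of the set on which they are smooth.
\<close>

definition lie_bracket ::
  "(real^'n \<Rightarrow> real^'n) \<Rightarrow> (real^'n \<Rightarrow> real^'n) \<Rightarrow> real^'n \<Rightarrow> real^'n" where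
  "lie_bracket v w = (\<lambda>x. jacobian v (at x) *v w x - jacobian w (at x) *v v x)"

primrec lie_ad ::
  "(real^'n \<Rightarrow> real^'n) \<Rightarrow> nat \<Rightarrow> (real^'n \<Rightarrow> real^'n) \<Rightarrow> real^'n \<Rightarrow> real^'n" where
  "lie_ad f 0 g = g"
| "lie_ad f (Suc k) g = lie_bracket f (lie_ad f k g)"

definition control_affine ::
  "(real^'n \<Rightarrow> real^'n) \<Rightarrow> ('m::finite \<Rightarrow> real^'n \<Rightarrow> real^'n) \<Rightarrow> real^'n \<Rightarrow> real^'m \<Rightarrow> real^'n" where
  "control_affine f g x u = f x + (\<Sum>i\<in>UNIV. u $ i *\<^sub>R g i x)"

text \<open>
  \<open>x\<close> solves \<open>x' = F x u\<close> on the time set \<open>J\<close>, except possibly at the times in \<open>N\<close>, where only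
  continuity is required. \<open>N = {}\<close> gives classical solutions; a countable \<open>N\<close> accommodates the
  switching times of piecewise continuous inputs.
\<close>

definition solves_off ::
  "real set \<Rightarrow> real set \<Rightarrow> (real^'n \<Rightarrow> real^'m \<Rightarrow> real^'n) \<Rightarrow> (real \<Rightarrow> real^'m) \<Rightarrow> (real \<Rightarrow> real^'n) \<Rightarrow> bool"
where
  "solves_off N J F u x \<longleftrightarrow>
     continuous_on J x \<and>
     (\<forall>t\<in>J - N. (x has_vector_derivative F (x t) (u t)) (at t within J))"

text \<open>The infimum of the empty set is \<open>\<infinity>\<close>.\<close>

definition exit_time :: "real set \<Rightarrow> 'a set \<Rightarrow> (real \<Rightarrow> 'a) \<Rightarrow> ereal" where
  "exit_time J V x = Inf (ereal ` {\<tau> \<in> J. 0 < \<tau> \<and> x \<tau> \<notin> V})"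

definition C2_diffeo_on :: "(real^'n) set \<Rightarrow> (real^'n \<Rightarrow> real^'n) \<Rightarrow> bool" where
  "C2_diffeo_on V \<Phi> \<longleftrightarrow>
     C_on 2 V \<Phi> \<and> inj_on \<Phi> V \<and> open (\<Phi> ` V) \<and> C_on 2 (\<Phi> ` V) (inv_into V \<Phi>)"

text \<open>
  The quantification ranges over all inputs and all trajectories in \<open>X\<close>, defined on \<open>[0,T)\<close> with
  \<open>T \<le> \<infinity>\<close>, that start in \<open>V\<close>; the image under \<open>\<Phi>\<close> has to solve the linear system, with the same
  input and the same exceptional times, until the trajectory leaves \<open>V\<close>.
\<close>

definition transforms_to_linear ::
  "(real^'n) set \<Rightarrow> (real^'n \<Rightarrow> real^'n) \<Rightarrow> ('m::finite \<Rightarrow> real^'n \<Rightarrow> real^'n) \<Rightarrow> (real^'n) set \<Rightarrow>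
   (real^'n \<Rightarrow> real^'n) \<Rightarrow> real^'n^'n \<Rightarrow> real^'m^'n \<Rightarrow> bool" where
  "transforms_to_linear X f g V \<Phi> A B \<longleftrightarrow>
     (\<forall>u x T N.
        let J = {t. 0 \<le> t \<and> ereal t < T} in
        countable N \<longrightarrow> (\<forall>t\<in>J. x t \<in> X) \<longrightarrow> x 0 \<in> V \<longrightarrow>
        solves_off N J (control_affine f g) u x \<longrightarrow>
        solves_off N {t \<in> J. ereal t < exit_time J V x}
          (\<lambda>z w. A *v z + B *v w) u (\<lambda>t. \<Phi> (x t)))"

text \<open>Matrix powers; the operator \<open>^\<close> on type \<open>vec\<close> is componentwise.\<close>

primrec mat_pow :: "real^'n^'n \<Rightarrow> nat \<Rightarrow> real^'n^'n" where
  "mat_pow A 0 = mat 1"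
| "mat_pow A (Suc k) = A ** mat_pow A k"

text \<open>
  The rank of \<open>[B, A B, \<dots>, A\<^sup>n\<^sup>-\<^sup>1 B]\<close>, expressed as the dimension of the span of its columns.
\<close>

definition controllable :: "real^'n^'n \<Rightarrow> real^'m^'n \<Rightarrow> bool" where
  "controllable A B \<longleftrightarrow>
     dim (span (\<Union>k\<le>CARD('n) - 1. columns (mat_pow A k ** B))) = CARD('n)"

definition linearizable_on ::
  "(real^'n) set \<Rightarrow> (real^'n \<Rightarrow> real^'n) \<Rightarrow> ('m::finite \<Rightarrow> real^'n \<Rightarrow> real^'n) \<Rightarrow> (real^'n) set \<Rightarrow> bool"
where
  "linearizable_on X f g V \<longleftrightarrow>
     (\<exists>\<Phi> A (B :: real^'m^'n).
        C2_diffeo_on V \<Phi> \<and> transforms_to_linear X f g V \<Phi> A B \<and> controllable A B)"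

definition ad_rank_condition ::
  "(real^'n \<Rightarrow> real^'n) \<Rightarrow> ('m::finite \<Rightarrow> real^'n \<Rightarrow> real^'n) \<Rightarrow> (real^'n) set \<Rightarrow> bool" where
  "ad_rank_condition f g V \<longleftrightarrow>
     (\<forall>x\<in>V. dim (span {lie_ad f j (g i) x | i j. j \<le> CARD('n) - 1}) = CARD('n))"

definition ad_commute_condition ::
  "(real^'n \<Rightarrow> real^'n) \<Rightarrow> ('m::finite \<Rightarrow> real^'n \<Rightarrow> real^'n) \<Rightarrow> (real^'n) set \<Rightarrow> bool" where
  "ad_commute_condition f g V \<longleftrightarrow>
     (\<forall>i j k l. \<forall>x\<in>V. lie_bracket (lie_ad f k (g i)) (lie_ad f l (g j)) x = 0)"

definition nbhd_in :: "'a::topological_space set \<Rightarrow> 'a \<Rightarrow> 'a set \<Rightarrow> bool" where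
  "nbhd_in X x V \<longleftrightarrow> open V \<and> x \<in> V \<and> V \<subseteq> X"

end

theory Submission
  imports Defs
begin

text \<open>
  Write \<open>D\<Phi>\<close> for the derivative of \<open>\<Phi>\<close>. For \<open>C\<^sup>2\<close> maps one has
  \<open>D\<Phi> [v,w] = D(D\<Phi> v) w - D(D\<Phi> w) v\<close>. If \<open>\<Phi>\<close> linearizes the system on \<open>V\<close>, then following
  trajectories with constant inputs from every point of \<open>V\<close> gives \<open>D\<Phi> f = A \<Phi>\<close> and
  \<open>D\<Phi> g\<^sub>i = B e\<^sub>i\<close>, hence \<open>D\<Phi> ad\<^sub>f\<^sup>k g\<^sub>i = A\<^sup>k B e\<^sub>i\<close>, and both conditions follow.

  Conversely, near \<open>x\<^sub>0\<close> choose a frame among the fields \<open>ad\<^sub>f\<^sup>j g\<^sub>i\<close>. It commutes, so its dual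
  one-forms are closed, and by Poincare's lemma they are the differential of a local
  diffeomorphism \<open>\<Phi>\<close> with \<open>\<Phi>(x\<^sub>0) = 0\<close>. All \<open>D\<Phi> ad\<^sub>f\<^sup>k g\<^sub>i\<close> have derivative \<open>0\<close> along the frame,
  so they are constant, and therefore \<open>D\<Phi> f\<close> has constant derivative along the frame; as \<open>f\<close>
  vanishes at \<open>x\<^sub>0\<close>, this means \<open>D\<Phi> f = A \<Phi>\<close>.
\<close>

section \<open>Calculus of \<open>C\<^sup>k\<close> maps\<close>

abbreviation fder :: "('a::real_normed_vector \<Rightarrow> 'b::real_normed_vector) \<Rightarrow> 'a \<Rightarrow> 'a \<Rightarrow> 'b"
  where "fder f x \<equiv> frechet_derivative f (at x)"

abbreviation C_inf_on :: "'a::euclidean_space set \<Rightarrow> ('a \<Rightarrow> 'b::real_normed_vector) \<Rightarrow> bool"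
  where "C_inf_on S f \<equiv> \<forall>k. C_on k S f"

lemma has_derivative_fder: "f differentiable (at x) \<Longrightarrow> (f has_derivative fder f x) (at x)"
  by (simp add: frechet_derivative_works)

lemma fder_eqI: "(f has_derivative f') (at x) \<Longrightarrow> fder f x = f'"
  using frechet_derivative_at[of f f' x] by simp

lemma linear_fder: "f differentiable (at x) \<Longrightarrow> linear (fder f x)"
  by (rule linear_frechet_derivative)

lemma differentiable_cong_open:
  assumes "open S" "x \<in> S" "\<And>y. y \<in> S \<Longrightarrow> f y = g y" "f differentiable (at x)"
  shows "g differentiable (at x)"
  using has_derivative_transform_within_open[OF _ assms(1,2), of f _ UNIV g] assms(3,4)
  unfolding differentiable_def by auto

text \<open>No differentiability is assumed: \<open>frechet_derivative\<close> is a choice among all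
  candidate derivatives, and two functions that agree near \<open>x\<close> have the same
  candidates.\<close>

lemma fder_cong_open:
  assumes "open S" "x \<in> S" "\<And>y. y \<in> S \<Longrightarrow> f y = g y"
  shows "fder f x = fder g x"
proof -
  have "(f has_derivative D) (at x) \<longleftrightarrow> (g has_derivative D) (at x)" for D
    using has_derivative_transform_within_open[OF _ assms(1,2), of f D UNIV g]
      has_derivative_transform_within_open[OF _ assms(1,2), of g D UNIV f] assms(3) by auto
  then show ?thesis
    by (simp add: frechet_derivative_def)
qed

lemma C_on_cong:
  assumes "open S" "\<And>x. x \<in> S \<Longrightarrow> f x = g x"
  shows "C_on k S f \<longleftrightarrow> C_on k S g"
  using assms(2)
proof (induction k arbitrary: f g)
  case 0
  then show ?case by (simp cong: continuous_on_cong)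
next
  case (Suc k)
  have "C_on k S (\<lambda>x. fder f x d) \<longleftrightarrow> C_on k S (\<lambda>x. fder g x d)" for d
    by (rule Suc.IH) (simp add: fder_cong_open[OF \<open>open S\<close> _ Suc.prems])
  moreover have "(\<forall>x\<in>S. f differentiable (at x)) \<longleftrightarrow> (\<forall>x\<in>S. g differentiable (at x))"
    using differentiable_cong_open[OF \<open>open S\<close>, of _ f g] differentiable_cong_open[OF \<open>open S\<close>, of _ g f]
      Suc.prems by auto
  ultimately show ?case by simp
qed

lemma C_on_subset: "C_on k S f \<Longrightarrow> T \<subseteq> S \<Longrightarrow> C_on k T f"
  by (induction k arbitrary: f) (auto intro: continuous_on_subset)

lemma C_on_SucD_differentiable: "C_on (Suc k) S f \<Longrightarrow> x \<in> S \<Longrightarrow> f differentiable (at x)"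
  by simp

lemma C_on_SucD_fder: "C_on (Suc k) S f \<Longrightarrow> C_on k S (\<lambda>x. fder f x d)"
  by simp

lemma C_on_Suc_imp: "C_on (Suc k) S f \<Longrightarrow> C_on k S f"
proof (induction k arbitrary: f)
  case 0
  then show ?case
    by (auto simp: continuous_on_eq_continuous_within
        intro: differentiable_imp_continuous_within differentiable_at_withinI)
next
  case (Suc k)
  then show ?case by auto
qed

text \<open>Allows a derivative to be supplied as an explicit formula in place of
  \<open>frechet_derivative\<close>; the inductions on the order of differentiability below all run
  through this rule.\<close>

lemma C_on_SucI:
  assumes "open S" "\<And>x. x \<in> S \<Longrightarrow> (f has_derivative f' x) (at x)"
    and "\<And>d. C_on k S (\<lambda>x. f' x d)"
  shows "C_on (Suc k) S f"
proof -
  have "C_on k S (\<lambda>x. fder f x d) \<longleftrightarrow> C_on k S (\<lambda>x. f' x d)" for d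
    by (rule C_on_cong[OF \<open>open S\<close>]) (simp add: fder_eqI[OF assms(2)])
  then show ?thesis
    using assms(2,3) by (auto simp: differentiable_def)
qed

lemma C_on_mono:
  assumes "C_on k S f" "j \<le> k"
  shows "C_on j S f"
  using assms(2,1) by (induction rule: inc_induct) (blast intro: C_on_Suc_imp)+

lemma C_on_continuous_on: "C_on k S f \<Longrightarrow> continuous_on S f"
  using C_on_mono[of k S f 0] by simp

lemma C_on_const: "C_on k S (\<lambda>x. c)"
proof (induction k arbitrary: c)
  case (Suc k)
  have "fder (\<lambda>x. c) x = (\<lambda>d. 0)" for x :: 'a
    by (rule fder_eqI) simp
  then show ?case using Suc by simp
qed simp

section \<open>Closure of \<open>C_on\<close> under algebraic operations and composition\<close>

lemma C_on_add:
  assumes "open S" "C_on k S f" "C_on k S g"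
  shows "C_on k S (\<lambda>x. f x + g x)"
  using assms(2,3)
proof (induction k arbitrary: f g)
  case 0
  then show ?case by (auto intro: continuous_intros)
next
  case (Suc k)
  show ?case
  proof (rule C_on_SucI[OF \<open>open S\<close>])
    show "((\<lambda>x. f x + g x) has_derivative (\<lambda>d. fder f x d + fder g x d)) (at x)" if "x \<in> S" for x
      using Suc.prems that by (auto intro!: derivative_eq_intros has_derivative_fder)
    show "C_on k S (\<lambda>x. fder f x d + fder g x d)" for d
      using Suc by (auto intro!: Suc.IH)
  qed
qed

text \<open>The product rule yields two products of the same shape with one factor differentiated,
  so the induction closes once \<open>f\<close> and \<open>g\<close> are generalized.\<close>

lemma C_on_bilinear:
  assumes "bounded_bilinear B" "open S" "C_on k S f" "C_on k S g"
  shows "C_on k S (\<lambda>x. B (f x) (g x))"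
  using assms(3,4)
proof (induction k arbitrary: f g)
  case 0
  then show ?case by (auto intro: bounded_bilinear.continuous_on[OF assms(1)])
next
  case (Suc k)
  show ?case
  proof (rule C_on_SucI[OF \<open>open S\<close>])
    show "((\<lambda>x. B (f x) (g x)) has_derivative
        (\<lambda>d. B (f x) (fder g x d) + B (fder f x d) (g x))) (at x)" if "x \<in> S" for x
      using Suc.prems that
      by (intro bounded_bilinear.FDERIV[OF assms(1)]) (auto intro: has_derivative_fder)
    have "C_on k S f" "C_on k S g"
      using Suc.prems by (auto dest: C_on_Suc_imp simp del: C_on.simps)
    then show "C_on k S (\<lambda>x. B (f x) (fder g x d) + B (fder f x d) (g x))" for d
      using Suc.prems by (intro C_on_add[OF \<open>open S\<close>] Suc.IH) auto
  qed
qed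

lemmas C_on_scaleR = C_on_bilinear[OF bounded_bilinear_scaleR]
lemmas C_on_mult = C_on_bilinear[OF bounded_bilinear_mult]

lemma C_on_bounded_linear:
  assumes "bounded_linear h" "open S" "C_on k S f"
  shows "C_on k S (\<lambda>x. h (f x))"
  using assms(3)
proof (induction k arbitrary: f)
  case 0
  then show ?case by (auto intro: bounded_linear.continuous_on[OF assms(1)])
next
  case (Suc k)
  show ?case
  proof (rule C_on_SucI[OF \<open>open S\<close>])
    show "((\<lambda>x. h (f x)) has_derivative (\<lambda>d. h (fder f x d))) (at x)" if "x \<in> S" for x
      using Suc.prems that
      by (intro bounded_linear.has_derivative[OF assms(1)]) (auto intro: has_derivative_fder)
    show "C_on k S (\<lambda>x. h (fder f x d))" for d
      using Suc by auto
  qed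
qed

lemma C_on_sum:
  assumes "open S" "finite I" "\<And>i. i \<in> I \<Longrightarrow> C_on k S (f i)"
  shows "C_on k S (\<lambda>x. \<Sum>i\<in>I. f i x)"
  using assms(2,3) by (induction I rule: finite_induct) (auto intro: C_on_const C_on_add[OF assms(1)])

text \<open>Replaces a direction that varies with the point by finitely many fixed directions, which
  are the only ones that \<open>C_on\<close> speaks about.\<close>

lemma linear_family_expand:
  fixes Y :: "'b::euclidean_space"
  assumes "linear w"
  shows "w Y = (\<Sum>b\<in>Basis. (Y \<bullet> b) *\<^sub>R w b)"
proof -
  have "w Y = w (\<Sum>b\<in>Basis. (Y \<bullet> b) *\<^sub>R b)"
    by (simp add: euclidean_representation)
  then show ?thesis
    by (simp only: linear_sum[OF assms] linear_cmul[OF assms])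
qed

text \<open>The chain rule produces a derivative of \<open>f\<close> in the moving direction
  \<open>fder h x d\<close>. Expanding that direction in the basis leaves products of components of
  \<open>fder h x d\<close> with \<open>fder f (h x) b\<close>, and the induction hypothesis applies
  to the latter because \<open>f\<close> is generalized.\<close>

lemma C_on_compose:
  fixes f :: "'b::euclidean_space \<Rightarrow> 'c::real_normed_vector" and h :: "'a::euclidean_space \<Rightarrow> 'b"
  assumes "open S" "C_on k T f" "C_on k S h" "h ` S \<subseteq> T"
  shows "C_on k S (\<lambda>x. f (h x))"
  using assms(2,3)
proof (induction k arbitrary: f)
  case 0
  then show ?case using assms(4) by (auto intro: continuous_on_compose2)
next
  case (Suc k)
  have hk: "C_on k S h"
    using Suc.prems(2) by (rule C_on_Suc_imp)
  show ?case
  proof (rule C_on_SucI[OF \<open>open S\<close>])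
    fix x assume x: "x \<in> S"
    then have d: "f differentiable (at (h x))" "h differentiable (at x)"
      using Suc.prems assms(4) by auto
    have "((\<lambda>x. f (h x)) has_derivative (\<lambda>d. fder f (h x) (fder h x d))) (at x)"
      using has_derivative_compose[OF has_derivative_fder[OF d(2)] has_derivative_fder[OF d(1)]] .
    moreover have "(\<lambda>d. fder f (h x) (fder h x d)) =
        (\<lambda>d. \<Sum>b\<in>Basis. (fder h x d \<bullet> b) *\<^sub>R fder f (h x) b)"
      by (rule ext, rule linear_family_expand[OF linear_fder[OF d(1)]])
    ultimately show "((\<lambda>x. f (h x)) has_derivative
        (\<lambda>d. \<Sum>b\<in>Basis. (fder h x d \<bullet> b) *\<^sub>R fder f (h x) b)) (at x)"
      by (simp only:)
  next
    have "C_on k S (\<lambda>x. fder f (h x) b)" for b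
      by (rule Suc.IH) (use Suc.prems hk in auto)
    moreover have "C_on k S (\<lambda>x. fder h x d \<bullet> b)" for d b
      using Suc.prems(2) by (intro C_on_bounded_linear[OF bounded_linear_inner_left] \<open>open S\<close>) simp
    ultimately show "C_on k S (\<lambda>x. \<Sum>b\<in>Basis. (fder h x d \<bullet> b) *\<^sub>R fder f (h x) b)" for d
      by (intro C_on_sum C_on_scaleR \<open>open S\<close>) auto
  qed
qed

text \<open>The derivative of the reciprocal is a product of the reciprocal itself and the
  derivative of \<open>f\<close>, so the induction hypothesis and closure under products
  suffice.\<close>

lemma C_on_inverse:
  fixes f :: "'a::euclidean_space \<Rightarrow> real"
  assumes "open S" "C_on k S f" "\<And>x. x \<in> S \<Longrightarrow> f x \<noteq> 0"
  shows "C_on k S (\<lambda>x. inverse (f x))"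
  using assms(2)
proof (induction k)
  case 0
  then show ?case using assms(3) by (auto intro: continuous_intros)
next
  case (Suc k)
  show ?case
  proof (rule C_on_SucI[OF \<open>open S\<close>])
    show "((\<lambda>x. inverse (f x)) has_derivative
        (\<lambda>d. - 1 * (inverse (f x) * fder f x d * inverse (f x)))) (at x)" if "x \<in> S" for x
      using Deriv.has_derivative_inverse[where f=f, OF assms(3)[OF that] has_derivative_fder[of f x]]
        Suc.prems that by simp
    have "C_on k S (\<lambda>x. inverse (f x))"
      using Suc.prems by (rule Suc.IH[OF C_on_Suc_imp])
    then show "C_on k S (\<lambda>x. - 1 * (inverse (f x) * fder f x d * inverse (f x)))" for d
      using Suc.prems by (intro C_on_mult[OF \<open>open S\<close>] C_on_const) auto
  qed
qed

lemma C_on_prod: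
  fixes f :: "'i \<Rightarrow> 'a::euclidean_space \<Rightarrow> real"
  assumes "open S" "finite I" "\<And>i. i \<in> I \<Longrightarrow> C_on k S (f i)"
  shows "C_on k S (\<lambda>x. \<Prod>i\<in>I. f i x)"
  using assms(2,3) by (induction I rule: finite_induct) (auto intro: C_on_const C_on_mult[OF assms(1)])

lemma C_on_vec_nth: "open S \<Longrightarrow> C_on k S f \<Longrightarrow> C_on k S (\<lambda>x. f x $ i)"
  by (rule C_on_bounded_linear[OF bounded_linear_vec_nth])

lemma C_on_vec_lambda:
  fixes f :: "'n::finite \<Rightarrow> 'a::euclidean_space \<Rightarrow> real"
  assumes "open S" "\<And>i. C_on k S (f i)"
  shows "C_on k S (\<lambda>x. \<chi> i. f i x)"
proof -
  have "(\<chi> i. f i x) = (\<Sum>i\<in>UNIV. f i x *\<^sub>R axis i 1)" for x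
    using basis_expansion[of "\<chi> i. f i x"] by (simp add: scalar_mult_eq_scaleR)
  then show ?thesis
    using assms by (auto intro!: C_on_sum C_on_scaleR C_on_const)
qed

section \<open>Linear maps depending on a point\<close>

text \<open>A product rule for evaluating a point-dependent linear map at a point-dependent vector.
  The first summand freezes the vector at \<open>Y x\<close>; expansion in the basis reduces
  everything to derivatives of \<open>w\<close> on fixed vectors.\<close>

lemma has_derivative_linear_family:
  fixes w :: "'a::real_normed_vector \<Rightarrow> 'b::euclidean_space \<Rightarrow> 'c::real_normed_vector"
  assumes "open S" "x \<in> S" "\<And>y. y \<in> S \<Longrightarrow> linear (w y)"
    and "\<And>d. (\<lambda>y. w y d) differentiable (at x)"
    and Y: "(Y has_derivative Y') (at x)"
  shows "((\<lambda>y. w y (Y y)) has_derivative (\<lambda>e. fder (\<lambda>y. w y (Y x)) x e + w x (Y' e))) (at x)"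
proof -
  have ex: "w y d = (\<Sum>b\<in>Basis. (d \<bullet> b) *\<^sub>R w y b)" if "y \<in> S" for y d
    using linear_family_expand[OF assms(3)[OF that]] .
  have wb: "((\<lambda>y. w y b) has_derivative fder (\<lambda>y. w y b) x) (at x)" for b
    using assms(4) by (rule has_derivative_fder)
  have 1: "((\<lambda>y. \<Sum>b\<in>Basis. (Y y \<bullet> b) *\<^sub>R w y b) has_derivative
      (\<lambda>e. \<Sum>b\<in>Basis. (Y x \<bullet> b) *\<^sub>R fder (\<lambda>y. w y b) x e + (Y' e \<bullet> b) *\<^sub>R w x b)) (at x)"
    by (intro has_derivative_sum has_derivative_scaleR wb
        bounded_linear.has_derivative[OF bounded_linear_inner_left] Y)
  have "((\<lambda>y. \<Sum>b\<in>Basis. (Y x \<bullet> b) *\<^sub>R w y b) has_derivative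
      (\<lambda>e. \<Sum>b\<in>Basis. (Y x \<bullet> b) *\<^sub>R fder (\<lambda>y. w y b) x e)) (at x)"
    by (intro has_derivative_sum has_derivative_scaleR_right wb)
  then have "((\<lambda>y. w y (Y x)) has_derivative
      (\<lambda>e. \<Sum>b\<in>Basis. (Y x \<bullet> b) *\<^sub>R fder (\<lambda>y. w y b) x e)) (at x)"
    by (rule has_derivative_transform_within_open[OF _ \<open>open S\<close> \<open>x \<in> S\<close>]) (simp add: ex[symmetric])
  then have 2: "fder (\<lambda>y. w y (Y x)) x = (\<lambda>e. \<Sum>b\<in>Basis. (Y x \<bullet> b) *\<^sub>R fder (\<lambda>y. w y b) x e)"
    by (rule fder_eqI)
  have "((\<lambda>y. w y (Y y)) has_derivative
      (\<lambda>e. \<Sum>b\<in>Basis. (Y x \<bullet> b) *\<^sub>R fder (\<lambda>y. w y b) x e + (Y' e \<bullet> b) *\<^sub>R w x b)) (at x)"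
    by (rule has_derivative_transform_within_open[OF 1 \<open>open S\<close> \<open>x \<in> S\<close>]) (simp add: ex[symmetric])
  then show ?thesis
    by (simp add: 2 sum.distrib ex[OF \<open>x \<in> S\<close>, symmetric])
qed

lemma C_on_linear_family:
  fixes w :: "'a::euclidean_space \<Rightarrow> 'b::euclidean_space \<Rightarrow> 'c::real_normed_vector"
  assumes "open S" "\<And>y. y \<in> S \<Longrightarrow> linear (w y)" "\<And>d. C_on k S (\<lambda>y. w y d)" "C_on k S Y"
  shows "C_on k S (\<lambda>y. w y (Y y))"
proof -
  have "C_on k S (\<lambda>y. \<Sum>b\<in>Basis. (Y y \<bullet> b) *\<^sub>R w y b)"
    by (intro C_on_sum C_on_scaleR assms C_on_bounded_linear[OF bounded_linear_inner_left]) auto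
  moreover have "C_on k S (\<lambda>y. w y (Y y)) \<longleftrightarrow> C_on k S (\<lambda>y. \<Sum>b\<in>Basis. (Y y \<bullet> b) *\<^sub>R w y b)"
    by (rule C_on_cong[OF assms(1)]) (rule linear_family_expand[OF assms(2)])
  ultimately show ?thesis
    by blast
qed

section \<open>Symmetry of second derivatives\<close>

text \<open>Both mixed derivatives are values of the same second difference, by the mean value theorem
  applied twice.\<close>

lemma second_difference_mvt:
  fixes h :: "'a::real_normed_vector \<Rightarrow> real"
  assumes s: "0 < s"
    and h: "\<And>a b. 0 \<le> a \<Longrightarrow> a \<le> s \<Longrightarrow> 0 \<le> b \<Longrightarrow> b \<le> s \<Longrightarrow> h differentiable (at (x + a *\<^sub>R u + b *\<^sub>R v))"
    and hu: "\<And>a b. 0 \<le> a \<Longrightarrow> a \<le> s \<Longrightarrow> 0 \<le> b \<Longrightarrow> b \<le> s \<Longrightarrow>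
      (\<lambda>y. fder h y u) differentiable (at (x + a *\<^sub>R u + b *\<^sub>R v))"
  obtains a b where "0 \<le> a" "a \<le> s" "0 \<le> b" "b \<le> s"
    and "h (x + s *\<^sub>R u + s *\<^sub>R v) - h (x + s *\<^sub>R u) - h (x + s *\<^sub>R v) + h x
      = s * s * fder (\<lambda>y. fder h y u) (x + a *\<^sub>R u + b *\<^sub>R v) v"
proof -
  have D: "((\<lambda>a. h (x + a *\<^sub>R u + b *\<^sub>R v)) has_derivative
      (\<lambda>t. fder h (x + a *\<^sub>R u + b *\<^sub>R v) (t *\<^sub>R u))) (at a within {0..s})"
    if "0 \<le> a" "a \<le> s" "0 \<le> b" "b \<le> s" for a b
    by (rule has_derivative_at_withinI,
        rule has_derivative_compose[where g=h and f="\<lambda>a. x + a *\<^sub>R u + b *\<^sub>R v",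
          OF _ has_derivative_fder[OF h[OF that]]])
       (auto intro!: derivative_eq_intros)
  have lin: "fder h (x + a *\<^sub>R u + b *\<^sub>R v) (t *\<^sub>R u) = t * fder h (x + a *\<^sub>R u + b *\<^sub>R v) u"
    if "0 \<le> a" "a \<le> s" "0 \<le> b" "b \<le> s" for a b t
    using linear_cmul[OF linear_fder[OF h[OF that]]] by simp
  \<comment> \<open>The increment of \<open>h\<close> across the side \<open>s *\<^sub>R v\<close>,
    as a function of the displacement along \<open>u\<close>. Its own increment from
    \<open>0\<close> to \<open>s\<close> is the second difference.\<close>
  define p where "p a = h (x + a *\<^sub>R u + s *\<^sub>R v) - h (x + a *\<^sub>R u + 0 *\<^sub>R v)" for a
  obtain a where a: "0 < a" "a < s" and pa: "p s - p 0 =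
      fder h (x + a *\<^sub>R u + s *\<^sub>R v) ((s-0) *\<^sub>R u) - fder h (x + a *\<^sub>R u + 0 *\<^sub>R v) ((s-0) *\<^sub>R u)"
  proof (rule mvt_simple[OF s, of p "\<lambda>a t. fder h (x + a *\<^sub>R u + s *\<^sub>R v) (t *\<^sub>R u) -
        fder h (x + a *\<^sub>R u + 0 *\<^sub>R v) (t *\<^sub>R u)", THEN bexE])
    show "(p has_derivative (\<lambda>t. fder h (x + a *\<^sub>R u + s *\<^sub>R v) (t *\<^sub>R u) -
        fder h (x + a *\<^sub>R u + 0 *\<^sub>R v) (t *\<^sub>R u))) (at a within {0..s})" if "0 \<le> a" "a \<le> s" for a
      unfolding p_def using that s by (intro has_derivative_diff D) auto
  qed auto
  have Db: "((\<lambda>b. fder h (x + a *\<^sub>R u + b *\<^sub>R v) u) has_derivative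
      (\<lambda>t. fder (\<lambda>y. fder h y u) (x + a *\<^sub>R u + b *\<^sub>R v) (t *\<^sub>R v))) (at b within {0..s})"
    if "0 \<le> b" "b \<le> s" for b
    by (rule has_derivative_at_withinI,
        rule has_derivative_compose[where g="\<lambda>y. fder h y u"
          and f="\<lambda>b. x + a *\<^sub>R u + b *\<^sub>R v", OF _ has_derivative_fder[OF hu]])
       (use that a in \<open>auto intro!: derivative_eq_intros\<close>)
  obtain b where b: "0 < b" "b < s" and pb: "fder h (x + a *\<^sub>R u + s *\<^sub>R v) u - fder h (x + a *\<^sub>R u + 0 *\<^sub>R v) u
      = fder (\<lambda>y. fder h y u) (x + a *\<^sub>R u + b *\<^sub>R v) ((s-0) *\<^sub>R v)"
    using mvt_simple[OF s Db] by auto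
  have "h (x + s *\<^sub>R u + s *\<^sub>R v) - h (x + s *\<^sub>R u) - h (x + s *\<^sub>R v) + h x = p s - p 0"
    by (simp add: p_def)
  also have "\<dots> = s * (fder h (x + a *\<^sub>R u + s *\<^sub>R v) u - fder h (x + a *\<^sub>R u + 0 *\<^sub>R v) u)"
    using lin[of a s s] lin[of a 0 s] a s by (simp add: pa right_diff_distrib)
  also have "\<dots> = s * s * fder (\<lambda>y. fder h y u) (x + a *\<^sub>R u + b *\<^sub>R v) v"
    unfolding pb using linear_cmul[OF linear_fder[OF hu[of a b]], of s v] a b by simp
  finally show thesis
    using a b by (intro that[of a b]) auto
qed

lemma fder_inner:
  assumes "f differentiable (at x)"
  shows "fder (\<lambda>y. f y \<bullet> c) x d = fder f x d \<bullet> c"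
  using fder_eqI[OF bounded_linear.has_derivative[OF bounded_linear_inner_left has_derivative_fder[OF assms], of c]]
  by simp

text \<open>If the two mixed derivatives differed at \<open>x\<close>, continuity would keep
  \<open>P\<close> and \<open>Q\<close> apart near \<open>x\<close>. The second difference of a
  small parallelogram, read in both orders, however gives equal values of \<open>P\<close> and
  \<open>Q\<close> at two points close to \<open>x\<close>.\<close>

lemma fder_symmetric_real:
  fixes h :: "'a::euclidean_space \<Rightarrow> real"
  assumes S: "open S" and C: "C_on 2 S h" and x: "x \<in> S"
  shows "fder (\<lambda>y. fder h y u) x v = fder (\<lambda>y. fder h y v) x u"
proof (rule ccontr)
  define P where "P = (\<lambda>y. fder (\<lambda>y. fder h y u) y v)"
  define Q where "Q = (\<lambda>y. fder (\<lambda>y. fder h y v) y u)"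
  have C': "\<And>y. y \<in> S \<Longrightarrow> h differentiable (at y)"
    "\<And>y d. y \<in> S \<Longrightarrow> (\<lambda>y. fder h y d) differentiable (at y)"
    and cont: "continuous_on S P" "continuous_on S Q"
    using C by (auto simp: numeral_2_eq_2 P_def Q_def)
  assume "\<not> ?thesis"
  then have e: "\<bar>P x - Q x\<bar> / 2 > 0"
    by (simp add: P_def Q_def)
  have "isCont P x" "isCont Q x"
    using cont S x by (auto simp: continuous_on_eq_continuous_at)
  then obtain d1 d2 where d: "d1 > 0" "\<And>y. dist y x < d1 \<Longrightarrow> dist (P y) (P x) < \<bar>P x - Q x\<bar> / 2"
      "d2 > 0" "\<And>y. dist y x < d2 \<Longrightarrow> dist (Q y) (Q x) < \<bar>P x - Q x\<bar> / 2"
    using e unfolding continuous_at_eps_delta by metis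
  obtain d3 where d3: "d3 > 0" "ball x d3 \<subseteq> S"
    using S x open_contains_ball by blast
  define r where "r = min d1 (min d2 d3)"
  have r: "r > 0" using d d3 by (simp add: r_def)
  \<comment> \<open>The parallelogram with sides \<open>s *\<^sub>R u\<close> and
    \<open>s *\<^sub>R v\<close> then stays within distance \<open>r / 2\<close> of
    \<open>x\<close>; the summand \<open>1\<close> keeps the denominator positive when both vectors
    vanish.\<close>
  define s where "s = r / (2 * (norm u + norm v + 1))"
  have n: "norm u + norm v + 1 > 0"
    by (smt (verit) norm_ge_zero)
  have s: "s > 0"
    unfolding s_def using r n by (auto intro!: divide_pos_pos)
  have close: "dist (x + a *\<^sub>R u + b *\<^sub>R v) x < r" if "0 \<le> a" "a \<le> s" "0 \<le> b" "b \<le> s" for a b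
  proof -
    have "dist (x + a *\<^sub>R u + b *\<^sub>R v) x \<le> a * norm u + b * norm v"
      using that norm_triangle_ineq[of "a *\<^sub>R u" "b *\<^sub>R v"] by (simp add: dist_norm)
    also have "\<dots> \<le> s * norm u + s * norm v"
      using that by (intro add_mono mult_right_mono) auto
    also have "\<dots> \<le> s * (norm u + norm v + 1)"
      using s by (simp add: algebra_simps)
    also have "\<dots> = r / 2"
      using n by (simp add: s_def field_simps)
    finally show ?thesis using r by linarith
  qed
  have inS: "x + a *\<^sub>R u + b *\<^sub>R v \<in> S" if "0 \<le> a" "a \<le> s" "0 \<le> b" "b \<le> s" for a b
    using close[OF that] d3(2) by (auto simp: r_def dist_commute)
  obtain a b where ab: "0 \<le> a" "a \<le> s" "0 \<le> b" "b \<le> s"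
    and 1: "h (x + s *\<^sub>R u + s *\<^sub>R v) - h (x + s *\<^sub>R u) - h (x + s *\<^sub>R v) + h x
      = s * s * P (x + a *\<^sub>R u + b *\<^sub>R v)"
    by (rule second_difference_mvt[OF s, of h x u v]) (auto simp: P_def intro: C' inS)
  have inS': "x + a *\<^sub>R v + b *\<^sub>R u \<in> S" if "0 \<le> a" "a \<le> s" "0 \<le> b" "b \<le> s" for a b
    using inS[of b a] that by (simp add: algebra_simps)
  \<comment> \<open>The same second difference with the roles of \<open>u\<close> and
    \<open>v\<close> exchanged; the left-hand side is symmetric in them.\<close>
  obtain a' b' where ab': "0 \<le> a'" "a' \<le> s" "0 \<le> b'" "b' \<le> s"
    and 2: "h (x + s *\<^sub>R v + s *\<^sub>R u) - h (x + s *\<^sub>R v) - h (x + s *\<^sub>R u) + h x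
      = s * s * Q (x + a' *\<^sub>R v + b' *\<^sub>R u)"
    by (rule second_difference_mvt[OF s, of h x v u]) (auto simp: Q_def intro: C' inS')
  have "P (x + a *\<^sub>R u + b *\<^sub>R v) = Q (x + a' *\<^sub>R v + b' *\<^sub>R u)"
    using 1 2 s by (simp add: algebra_simps)
  moreover have "dist (P (x + a *\<^sub>R u + b *\<^sub>R v)) (P x) < \<bar>P x - Q x\<bar> / 2"
    using close[OF ab] by (intro d) (simp add: r_def)
  moreover have "dist (Q (x + a' *\<^sub>R v + b' *\<^sub>R u)) (Q x) < \<bar>P x - Q x\<bar> / 2"
    using close[of b' a'] ab' by (intro d) (simp add: r_def algebra_simps)
  ultimately show False
    unfolding dist_real_def by (smt (verit) field_sum_of_halves)
qed

text \<open>Pairing with an arbitrary vector \<open>c\<close> reduces the claim to real-valued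
  functions, and a vector is determined by its inner products.\<close>

lemma fder_symmetric:
  fixes f :: "'a::euclidean_space \<Rightarrow> 'b::real_inner"
  assumes S: "open S" and C: "C_on 2 S f" and x: "x \<in> S"
  shows "fder (\<lambda>y. fder f y u) x v = fder (\<lambda>y. fder f y v) x u"
proof -
  have d: "f differentiable (at y)" "(\<lambda>y. fder f y e) differentiable (at y)" if "y \<in> S" for y e
    using C that by (auto simp: numeral_2_eq_2)
  have "fder (\<lambda>y. fder (\<lambda>z. f z \<bullet> c) y u) x v = fder (\<lambda>y. fder f y u) x v \<bullet> c" for c u v
    using fder_cong_open[OF S x, of "\<lambda>y. fder (\<lambda>z. f z \<bullet> c) y u" "\<lambda>y. fder f y u \<bullet> c"]
    by (simp add: d x fder_inner)
  moreover have "C_on 2 S (\<lambda>z. f z \<bullet> c)" for c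
    by (rule C_on_bounded_linear[OF bounded_linear_inner_left S C])
  ultimately have "fder (\<lambda>y. fder f y u) x v \<bullet> c = fder (\<lambda>y. fder f y v) x u \<bullet> c" for c
    using fder_symmetric_real[OF S _ x, of "\<lambda>z. f z \<bullet> c" u v] by simp
  then show ?thesis
    using vector_eq_rdot by blast
qed

section \<open>Lie brackets in linearizing coordinates\<close>

lemma jacobian_vector:
  fixes v :: "real^'n \<Rightarrow> real^'p"
  assumes "v differentiable (at x)"
  shows "jacobian v (at x) *v d = fder v x d"
  using fder_eqI[of v _ x] jacobian_works[of v "at x"] assms by simp

lemma lie_bracket_eq:
  assumes "v differentiable (at x)" "w differentiable (at x)"
  shows "lie_bracket v w x = fder v x (w x) - fder w x (v x)"
  by (simp add: lie_bracket_def jacobian_vector assms)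

lemma C_inf_onD:
  assumes "C_inf_on S f" "x \<in> S"
  shows "f differentiable (at x)"
  using C_on_SucD_differentiable[of 0 S f x] assms by blast

lemma C_inf_on_fder: "C_inf_on S f \<Longrightarrow> C_inf_on S (\<lambda>x. fder f x d)"
  using C_on_SucD_fder[of _ S f d] by blast

text \<open>A bracket costs one derivative, which is harmless when all orders are available;
  iterated brackets can therefore be formed freely.\<close>

lemma C_inf_on_lie_bracket:
  assumes "open S" "C_inf_on S v" "C_inf_on S w"
  shows "C_inf_on S (lie_bracket v w)"
proof
  fix k
  have D: "linear (fder v x)" "linear (fder w x)" if "x \<in> S" for x
    using that by (auto intro!: linear_fder C_inf_onD[OF assms(2)] C_inf_onD[OF assms(3)])
  have k: "C_on k S v" "C_on k S w"
    using assms by auto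
  have k': "C_on k S (\<lambda>x. fder v x d)" "C_on k S (\<lambda>x. fder w x d)" for d
    by (rule C_inf_on_fder[OF assms(2), rule_format], rule C_inf_on_fder[OF assms(3), rule_format])
  have "C_on k S (\<lambda>x. fder v x (w x) + (-1) *\<^sub>R fder w x (v x))"
    using C_on_linear_family[OF assms(1) D(1) k'(1) k(2)] C_on_linear_family[OF assms(1) D(2) k'(2) k(1)]
    by (intro C_on_add C_on_scaleR C_on_const assms(1))
  moreover have "C_on k S (lie_bracket v w) \<longleftrightarrow> C_on k S (\<lambda>x. fder v x (w x) + (-1) *\<^sub>R fder w x (v x))"
    by (rule C_on_cong[OF assms(1)])
      (simp add: lie_bracket_eq C_inf_onD[OF assms(2)] C_inf_onD[OF assms(3)])
  ultimately show "C_on k S (lie_bracket v w)"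
    by blast
qed

lemma C_inf_on_lie_ad:
  assumes "open S" "C_inf_on S f" "C_inf_on S g"
  shows "C_inf_on S (lie_ad f k g)"
proof (induction k)
  case 0
  then show ?case using assms(3) by simp
next
  case (Suc k)
  then show ?case using C_inf_on_lie_bracket[OF assms(1,2)] by simp
qed

text \<open>On an open subset, derivatives depend only on the values there, so \<open>f\<close>
  inherits them from its smooth extension \<open>F\<close>.\<close>

lemma smooth_on_imp_C_inf_on:
  assumes "smooth_on X f" "open V" "V \<subseteq> X"
  shows "C_inf_on V f"
proof -
  from assms(1) obtain U F where U: "X \<subseteq> U" and F: "\<forall>k. C_on k U F" and eq: "\<forall>x\<in>X. f x = F x"
    unfolding smooth_on_def by (elim exE conjE)
  have "C_on k V F" for k
    using C_on_subset[OF F[rule_format]] U assms(3) by simp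
  moreover have "C_on k V f \<longleftrightarrow> C_on k V F" for k
    by (rule C_on_cong[OF assms(2)]) (use eq assms(3) in auto)
  ultimately show ?thesis
    by blast
qed

lemma differentiable_linear_family:
  fixes w :: "'a::real_normed_vector \<Rightarrow> 'b::euclidean_space \<Rightarrow> 'c::real_normed_vector"
  assumes "open S" "x \<in> S" "\<And>y. y \<in> S \<Longrightarrow> linear (w y)"
    and "\<And>d. (\<lambda>y. w y d) differentiable (at x)" and "Y differentiable (at x)"
  shows "(\<lambda>y. w y (Y y)) differentiable (at x)"
    and "fder (\<lambda>y. w y (Y y)) x e = fder (\<lambda>y. w y (Y x)) x e + w x (fder Y x e)"
proof -
  note D = has_derivative_linear_family[OF assms(1-4) has_derivative_fder[OF assms(5)]]
  show "(\<lambda>y. w y (Y y)) differentiable (at x)"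
    using D by (auto simp: differentiable_def)
  show "fder (\<lambda>y. w y (Y y)) x e = fder (\<lambda>y. w y (Y x)) x e + w x (fder Y x e)"
    using fder_eqI[OF D] by simp
qed

text \<open>The second derivatives of \<open>\<Phi>\<close> cancel by symmetry.\<close>

lemma fder_lie_bracket:
  fixes \<Phi> :: "real^'n \<Rightarrow> 'b::real_inner"
  assumes S: "open S" "x \<in> S" and \<Phi>: "C_on 2 S \<Phi>"
    and YZ: "Y differentiable (at x)" "Z differentiable (at x)"
  shows "fder \<Phi> x (lie_bracket Y Z x)
    = fder (\<lambda>y. fder \<Phi> y (Y y)) x (Z x) - fder (\<lambda>y. fder \<Phi> y (Z y)) x (Y x)"
proof -
  have d: "\<Phi> differentiable (at y)" "(\<lambda>y. fder \<Phi> y e) differentiable (at y)" if "y \<in> S" for y e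
    using \<Phi> that by (auto simp: numeral_2_eq_2)
  have 1: "fder (\<lambda>y. fder \<Phi> y (Y y)) x (Z x) = fder (\<lambda>y. fder \<Phi> y (Y x)) x (Z x) + fder \<Phi> x (fder Y x (Z x))"
    by (rule differentiable_linear_family(2)[OF S]) (use d S YZ in \<open>auto intro: linear_fder\<close>)
  have 2: "fder (\<lambda>y. fder \<Phi> y (Z y)) x (Y x) = fder (\<lambda>y. fder \<Phi> y (Z x)) x (Y x) + fder \<Phi> x (fder Z x (Y x))"
    by (rule differentiable_linear_family(2)[OF S]) (use d S YZ in \<open>auto intro: linear_fder\<close>)
  show ?thesis
    using linear_diff[OF linear_fder[OF d(1)[OF S(2)]]] fder_symmetric[OF S(1) \<Phi> S(2), of "Y x" "Z x"]
    by (simp add: lie_bracket_eq YZ 1 2)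
qed

lemma fder_const [simp]: "fder (\<lambda>y. c) x = (\<lambda>e. 0)"
  by (rule fder_eqI) simp

lemma fder_cong_const:
  assumes "open S" "x \<in> S" "\<And>y. y \<in> S \<Longrightarrow> f y = c"
  shows "fder f x = (\<lambda>e. 0)"
  using fder_cong_open[OF assms(1,2), of f "\<lambda>y. c"] assms(3) by simp

section \<open>Images of brackets under linearizing coordinates\<close>

text \<open>Fields that become constant in the coordinates commute: both terms of the bracket
  formula differentiate a constant.\<close>

lemma fder_lie_bracket_const:
  fixes \<Phi> :: "real^'n \<Rightarrow> real^'p"
  assumes S: "open S" "x \<in> S" and \<Phi>: "C_on 2 S \<Phi>"
    and YZ: "Y differentiable (at x)" "Z differentiable (at x)"
    and c: "\<And>y. y \<in> S \<Longrightarrow> fder \<Phi> y (Y y) = c" "\<And>y. y \<in> S \<Longrightarrow> fder \<Phi> y (Z y) = d"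
  shows "fder \<Phi> x (lie_bracket Y Z x) = 0"
  using fder_lie_bracket[OF S \<Phi> YZ] fder_cong_const[OF S c(1)] fder_cong_const[OF S c(2)] by simp

text \<open>In coordinates this is the bracket of the linear field \<open>A *v z\<close> with a
  constant field \<open>c\<close>. With the sign convention used here it equals
  \<open>A *v c\<close>, without a minus sign.\<close>

lemma fder_lie_bracket_linear:
  fixes \<Phi> :: "real^'n \<Rightarrow> real^'n"
  assumes S: "open S" "x \<in> S" and \<Phi>: "C_on 2 S \<Phi>"
    and fY: "f differentiable (at x)" "Y differentiable (at x)"
    and f: "\<And>y. y \<in> S \<Longrightarrow> fder \<Phi> y (f y) = A *v \<Phi> y"
    and Y: "\<And>y. y \<in> S \<Longrightarrow> fder \<Phi> y (Y y) = c"
  shows "fder \<Phi> x (lie_bracket f Y x) = A *v c"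
proof -
  have "\<Phi> differentiable (at x)"
    using \<Phi> S by (auto simp: numeral_2_eq_2)
  then have "((\<lambda>y. A *v \<Phi> y) has_derivative (\<lambda>e. A *v fder \<Phi> x e)) (at x)"
    by (intro bounded_linear.has_derivative[OF matrix_vector_mul_bounded_linear] has_derivative_fder)
  then have "fder (\<lambda>y. fder \<Phi> y (f y)) x = (\<lambda>e. A *v fder \<Phi> x e)"
    using fder_cong_open[OF S, of "\<lambda>y. fder \<Phi> y (f y)" "\<lambda>y. A *v \<Phi> y"] f
    by (simp add: fder_eqI)
  then show ?thesis
    using fder_lie_bracket[OF S \<Phi> fY] fder_cong_const[OF S Y] Y[OF S(2)] by simp
qed

text \<open>Each further bracket with \<open>f\<close> multiplies the constant image by
  \<open>A\<close> once more, and the image stays constant on \<open>S\<close>, as the next step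
  requires.\<close>

lemma fder_lie_ad:
  fixes \<Phi> :: "real^'n \<Rightarrow> real^'n"
  assumes S: "open S" and \<Phi>: "C_on 2 S \<Phi>" and C: "C_inf_on S f" "C_inf_on S g"
    and f: "\<And>y. y \<in> S \<Longrightarrow> fder \<Phi> y (f y) = A *v \<Phi> y"
    and g: "\<And>y. y \<in> S \<Longrightarrow> fder \<Phi> y (g y) = b"
    and x: "x \<in> S"
  shows "fder \<Phi> x (lie_ad f k g x) = mat_pow A k *v b"
  using x
proof (induction k arbitrary: x)
  case 0
  then show ?case using g by simp
next
  case (Suc k)
  have "fder \<Phi> x (lie_bracket f (lie_ad f k g) x) = A *v (mat_pow A k *v b)"
    by (rule fder_lie_bracket_linear[OF S _ \<Phi>])
      (use Suc f in \<open>auto intro: C_inf_onD[OF C(1)] C_inf_onD[OF C_inf_on_lie_ad[OF S C]]\<close>)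
  then show ?case
    by (simp add: matrix_vector_mul_assoc)
qed

lemma mat_pow_column: "mat_pow A k *v column i B = column i (mat_pow A k ** B)"
  by (simp add: column_def matrix_vector_mult_def matrix_matrix_mult_def vec_eq_iff)

text \<open>\<open>fder \<Phi> x\<close> maps the spanning set of the rank condition onto the set of columns of the
  controllability matrix.\<close>

lemma controllable_iff_dim_span_lie_ad:
  fixes \<Phi> :: "real^'n \<Rightarrow> real^'n" and g :: "'m::finite \<Rightarrow> real^'n \<Rightarrow> real^'n"
  assumes ad: "\<And>i k. fder \<Phi> x (lie_ad f k (g i) x) = mat_pow A k *v column i B"
    and lin: "linear (fder \<Phi> x)" and inj: "inj (fder \<Phi> x)"
  shows "controllable A B \<longleftrightarrow>
    dim (span {lie_ad f j (g i) x | i j. j \<le> CARD('n) - 1}) = CARD('n)"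
proof -
  have "(\<Union>k\<le>CARD('n) - 1. columns (mat_pow A k ** B))
      = fder \<Phi> x ` {lie_ad f j (g i) x | i j. j \<le> CARD('n) - 1}"
    unfolding columns_def mat_pow_column[symmetric] ad[symmetric] by blast
  then have "controllable A B \<longleftrightarrow>
      dim (fder \<Phi> x ` {lie_ad f j (g i) x | i j. j \<le> CARD('n) - 1}) = CARD('n)"
    by (simp add: controllable_def dim_span)
  also have "dim (fder \<Phi> x ` {lie_ad f j (g i) x | i j. j \<le> CARD('n) - 1})
      = dim {lie_ad f j (g i) x | i j. j \<le> CARD('n) - 1}"
    by (rule dim_image_eq[OF lin]) (use inj in \<open>auto intro: inj_on_subset\<close>)
  finally show ?thesis
    by (simp add: dim_span)
qed

section \<open>The two conditions in linearizing coordinates\<close>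

text \<open>Differentiating the identity \<open>inv_into V \<Phi> (\<Phi> y) = y\<close> gives a
  left inverse of \<open>fder \<Phi> x\<close>.\<close>

lemma C2_diffeo_on_inj_fder:
  assumes V: "open V" "x \<in> V" and \<Phi>: "C2_diffeo_on V \<Phi>"
  shows "inj (fder \<Phi> x)"
proof -
  let ?\<Psi> = "inv_into V \<Phi>"
  have 1: "(\<Phi> has_derivative fder \<Phi> x) (at x)"
    using \<Phi> V by (intro has_derivative_fder) (auto simp: C2_diffeo_on_def numeral_2_eq_2)
  have 2: "(?\<Psi> has_derivative fder ?\<Psi> (\<Phi> x)) (at (\<Phi> x))"
    using \<Phi> V by (intro has_derivative_fder) (auto simp: C2_diffeo_on_def numeral_2_eq_2)
  have "((\<lambda>y. ?\<Psi> (\<Phi> y)) has_derivative (\<lambda>d. fder ?\<Psi> (\<Phi> x) (fder \<Phi> x d))) (at x)"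
    using has_derivative_compose[OF 1 2] .
  moreover have "((\<lambda>y. ?\<Psi> (\<Phi> y)) has_derivative (\<lambda>d. d)) (at x)"
    by (rule has_derivative_transform_within_open[OF has_derivative_ident V])
      (use \<Phi> in \<open>simp add: C2_diffeo_on_def\<close>)
  ultimately have "(\<lambda>d. fder ?\<Psi> (\<Phi> x) (fder \<Phi> x d)) = (\<lambda>d. d)"
    by (rule has_derivative_unique)
  then have "fder ?\<Psi> (\<Phi> x) (fder \<Phi> x d) = d" for d
    by (rule fun_cong)
  then show ?thesis
    by (rule inj_on_inverseI)
qed

lemma linear_coords_imp_conditions:
  fixes \<Phi> :: "real^'n \<Rightarrow> real^'n" and g :: "'m::finite \<Rightarrow> real^'n \<Rightarrow> real^'n"
  assumes V: "open V" and \<Phi>: "C2_diffeo_on V \<Phi>" and AB: "controllable A B"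
    and C: "C_inf_on V f" "\<And>i. C_inf_on V (g i)"
    and f: "\<And>y. y \<in> V \<Longrightarrow> fder \<Phi> y (f y) = A *v \<Phi> y"
    and g: "\<And>y i. y \<in> V \<Longrightarrow> fder \<Phi> y (g i y) = column i B"
  shows "ad_rank_condition f g V" "ad_commute_condition f g V"
proof -
  have \<Phi>2: "C_on 2 V \<Phi>"
    using \<Phi> by (simp add: C2_diffeo_on_def)
  then have lin: "linear (fder \<Phi> x)" if "x \<in> V" for x
    using that by (auto simp: numeral_2_eq_2 intro: linear_fder)
  have ad: "fder \<Phi> x (lie_ad f k (g i) x) = mat_pow A k *v column i B" if "x \<in> V" for x k i
    using fder_lie_ad[OF V \<Phi>2 C f g that] .
  show "ad_rank_condition f g V"
    unfolding ad_rank_condition_def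
    using controllable_iff_dim_span_lie_ad[OF ad lin C2_diffeo_on_inj_fder[OF V _ \<Phi>]] AB by blast
  show "ad_commute_condition f g V"
    unfolding ad_commute_condition_def
  proof (intro allI ballI)
    fix i j k l x assume x: "x \<in> V"
    have D: "lie_ad f k (g i) differentiable (at x)" for i k
      by (rule C_inf_onD[OF C_inf_on_lie_ad[OF V C] x])
    \<comment> \<open>Both fields have constant images by \<open>ad\<close>, so the image of their
      bracket vanishes; injectivity of \<open>fder \<Phi> x\<close> then removes the bracket
      itself.\<close>
    have "fder \<Phi> x (lie_bracket (lie_ad f k (g i)) (lie_ad f l (g j)) x) = 0"
      using fder_lie_bracket_const[OF V x \<Phi>2 D D ad ad] .
    then show "lie_bracket (lie_ad f k (g i)) (lie_ad f l (g j)) x = 0"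
      using linear_injective_0[OF lin[OF x]] C2_diffeo_on_inj_fder[OF V x \<Phi>] by blast
  qed
qed

section \<open>Local trajectories and necessity\<close>

text \<open>Picard iteration: the integral operator contracts the supremum distance by the factor
  \<open>L * T\<close>, so it has a fixed point, and a fixed point is differentiable by the
  fundamental theorem of calculus.\<close>

lemma ode_exists_Lipschitz:
  fixes G :: "'a::euclidean_space \<Rightarrow> 'a"
  assumes L: "0 \<le> L" "\<And>a b. dist (G a) (G b) \<le> L * dist a b" and T: "0 \<le> T" "L * T < 1"
  obtains y where "y 0 = x" "\<And>t. t \<in> {0..T} \<Longrightarrow> (y has_vector_derivative G (y t)) (at t within {0..T})"
proof -
  have contG: "continuous_on UNIV G"
    by (rule lipschitz_on_continuous_on[of L]) (use L in \<open>auto simp: lipschitz_on_def\<close>)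
  have cG: "continuous_on S (\<lambda>s. G (apply_bcontfun \<phi> s))" for \<phi> :: "real \<Rightarrow>\<^sub>C 'a" and S
    by (rule continuous_on_compose2[OF contG]) auto
  define h where "h \<phi> t = x + integral {0..t} (\<lambda>s. G (apply_bcontfun \<phi> s))" for \<phi> :: "real \<Rightarrow>\<^sub>C 'a" and t
  \<comment> \<open>Clamping the time to the interval from \<open>0\<close> to \<open>T\<close>
    turns the Picard image into a bounded continuous function on the whole line, so the iteration
    lives in a complete metric space.\<close>
  have "\<exists>q :: real \<Rightarrow>\<^sub>C 'a. \<forall>t. apply_bcontfun q t = h \<phi> (clamp 0 T t)" for \<phi>
  proof -
    have "continuous_on (cbox 0 T) (h \<phi>)"
      unfolding h_def cbox_interval
      by (intro continuous_on_add continuous_on_const indefinite_integral_continuous_1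
          integrable_continuous_interval cG)
    then show ?thesis
      by (rule continuous_on_cbox_bcontfunE) blast
  qed
  then obtain Q :: "(real \<Rightarrow>\<^sub>C 'a) \<Rightarrow> (real \<Rightarrow>\<^sub>C 'a)" where Q: "\<And>\<phi> t. apply_bcontfun (Q \<phi>) t = h \<phi> (clamp 0 T t)"
    by metis
  have "dist (Q \<phi>) (Q \<psi>) \<le> (L * T) * dist \<phi> \<psi>" for \<phi> \<psi>
  proof (rule dist_bound)
    fix t
    define c where "c = clamp 0 T t"
    have c: "0 \<le> c" "c \<le> T"
      using clamp_in_interval[of 0 T t] T by (auto simp: c_def)
    have "dist (apply_bcontfun (Q \<phi>) t) (apply_bcontfun (Q \<psi>) t)
        = norm (integral {0..c} (\<lambda>s. G (apply_bcontfun \<phi> s)) - integral {0..c} (\<lambda>s. G (apply_bcontfun \<psi> s)))"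
      by (simp add: Q h_def c_def dist_norm)
    also have "\<dots> = norm (integral {0..c} (\<lambda>s. G (apply_bcontfun \<phi> s) - G (apply_bcontfun \<psi> s)))"
      by (subst Henstock_Kurzweil_Integration.integral_diff) (auto intro: integrable_continuous_interval cG)
    also have "\<dots> \<le> (L * dist \<phi> \<psi>) * (c - 0)"
    proof (rule integral_bound[OF c(1)])
      show "continuous_on {0..c} (\<lambda>s. G (apply_bcontfun \<phi> s) - G (apply_bcontfun \<psi> s))"
        by (intro continuous_intros cG)
      show "norm (G (apply_bcontfun \<phi> s) - G (apply_bcontfun \<psi> s)) \<le> L * dist \<phi> \<psi>" for s
        using L(2)[of "apply_bcontfun \<phi> s" "apply_bcontfun \<psi> s"]
          mult_left_mono[OF dist_bounded[of \<phi> s \<psi>] L(1)] by (simp add: dist_norm)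
    qed
    also have "\<dots> \<le> (L * dist \<phi> \<psi>) * T"
      using c L(1) by (intro mult_left_mono) auto
    finally show "dist (apply_bcontfun (Q \<phi>) t) (apply_bcontfun (Q \<psi>) t) \<le> (L * T) * dist \<phi> \<psi>"
      by (simp add: algebra_simps)
  qed
  then have "\<exists>!\<phi>. Q \<phi> = \<phi>"
    using L(1) T by (intro banach_fix_type[of "L * T"]) auto
  then obtain \<phi> where "Q \<phi> = \<phi>"
    by blast
  then have fixp: "apply_bcontfun \<phi> t = x + integral {0..t} (\<lambda>s. G (apply_bcontfun \<phi> s))" if "t \<in> {0..T}" for t
    using Q[of \<phi> t] that by (simp add: h_def)
  show thesis
  proof
    show "apply_bcontfun \<phi> 0 = x"
      using fixp[of 0] T by simp
    fix t assume t: "t \<in> {0..T}"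
    have "((\<lambda>t. x + integral {0..t} (\<lambda>s. G (apply_bcontfun \<phi> s))) has_vector_derivative
        0 + G (apply_bcontfun \<phi> t)) (at t within {0..T})"
      by (intro has_vector_derivative_add has_vector_derivative_const integral_has_vector_derivative cG t)
    then show "(apply_bcontfun \<phi> has_vector_derivative G (apply_bcontfun \<phi> t)) (at t within {0..T})"
      by (auto intro: has_vector_derivative_transform[OF t fixp])
  qed
qed

text \<open>The derivative along each basis vector is bounded on the compact ball. The sum of these
  bounds controls the operator norm, and the mean value inequality on the convex ball does the
  rest.\<close>

lemma C_on_Lipschitz_cball:
  fixes F :: "'a::euclidean_space \<Rightarrow> 'b::real_normed_vector"
  assumes "C_on 1 V F" "cball x r \<subseteq> V"
  obtains L where "0 \<le> L" "\<And>a b. a \<in> cball x r \<Longrightarrow> b \<in> cball x r \<Longrightarrow> dist (F a) (F b) \<le> L * dist a b"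
proof -
  have "\<exists>K. \<forall>y\<in>cball x r. norm (fder F y b) \<le> K" for b
  proof -
    have "continuous_on (cball x r) (\<lambda>y. fder F y b)"
      using assms by (auto intro: continuous_on_subset)
    then have "bounded ((\<lambda>y. fder F y b) ` cball x r)"
      by (intro compact_imp_bounded compact_continuous_image) auto
    then show ?thesis
      by (auto simp: bounded_iff)
  qed
  then obtain K where K: "\<And>b y. y \<in> cball x r \<Longrightarrow> norm (fder F y b) \<le> K b"
    by metis
  define L where "L = (\<Sum>b\<in>Basis. \<bar>K b\<bar>)"
  have lin: "linear (fder F y)" "F differentiable (at y)" if "y \<in> cball x r" for y
  proof -
    have "y \<in> V" using that assms(2) by blast
    then show "F differentiable (at y)" "linear (fder F y)"
      using assms(1) by (auto intro: linear_fder)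
  qed
  have "norm (fder F y d) \<le> L * norm d" if y: "y \<in> cball x r" for y d
  proof -
    have "norm (fder F y d) = norm (\<Sum>b\<in>Basis. (d \<bullet> b) *\<^sub>R fder F y b)"
      using linear_family_expand[OF lin(1)[OF y], of d] by simp
    also have "\<dots> \<le> (\<Sum>b\<in>Basis. \<bar>K b\<bar> * norm d)"
    proof (rule sum_norm_le)
      fix b :: 'a assume b: "b \<in> Basis"
      have "\<bar>d \<bullet> b\<bar> * norm (fder F y b) \<le> norm d * \<bar>K b\<bar>"
        using Basis_le_norm[OF b, of d] K[OF y, of b] by (intro mult_mono) auto
      then show "norm ((d \<bullet> b) *\<^sub>R fder F y b) \<le> \<bar>K b\<bar> * norm d"
        by (simp add: mult.commute)
    qed
    finally show ?thesis
      by (simp add: L_def sum_distrib_right)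
  qed
  then have "onorm (fder F y) \<le> L" if "y \<in> cball x r" for y
    using that by (blast intro: onorm_le)
  moreover have "(F has_derivative fder F y) (at y within cball x r)" if "y \<in> cball x r" for y
    by (rule has_derivative_at_withinI[OF has_derivative_fder[OF lin(2)[OF that]]])
  ultimately have "norm (F a - F b) \<le> L * norm (a - b)" if "a \<in> cball x r" "b \<in> cball x r" for a b
    using differentiable_bound[OF convex_cball _ _ that, of F "fder F" L] by blast
  moreover have "0 \<le> L"
    by (simp add: L_def sum_nonneg)
  ultimately show thesis
    by (intro that[of L]) (auto simp: dist_norm)
qed

text \<open>Composing the vector field with the metric projection onto a ball makes it globally
  Lipschitz without changing it on the ball.\<close>

lemma ode_exists_C1:
  fixes F :: "'a::euclidean_space \<Rightarrow> 'a"
  assumes V: "open V" "x \<in> V" and F: "C_on 1 V F"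
  obtains T y where "0 < T" "y 0 = x"
    and "\<And>t. t \<in> {0..T} \<Longrightarrow> y t \<in> V \<and> (y has_vector_derivative F (y t)) (at t within {0..T})"
proof -
  obtain r where r: "r > 0" "cball x r \<subseteq> V"
    using V open_contains_cball by blast
  obtain L where L: "0 \<le> L" "\<And>a b. a \<in> cball x r \<Longrightarrow> b \<in> cball x r \<Longrightarrow> dist (F a) (F b) \<le> L * dist a b"
    using C_on_Lipschitz_cball[OF F r(2)] by blast
  let ?p = "closest_point (cball x r)"
  \<comment> \<open>Keeps \<open>L * T\<close> strictly below \<open>1\<close>, also when
    \<open>L\<close> is \<open>0\<close>.\<close>
  define T where "T = 1 / (L + 1)"
  have T: "0 < T" "L * T < 1"
    using L(1) by (auto simp: T_def field_simps)
  have ne: "cball x r \<noteq> {}" using r by auto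
  have "dist (F (?p a)) (F (?p b)) \<le> L * dist a b" for a b
  proof -
    have "dist (F (?p a)) (F (?p b)) \<le> L * dist (?p a) (?p b)"
      using closest_point_in_set[OF closed_cball ne] by (intro L) auto
    also have "\<dots> \<le> L * dist a b"
      by (intro mult_left_mono closest_point_lipschitz L ne) auto
    finally show ?thesis .
  qed
  then obtain y where y: "y 0 = x"
    "\<And>t. t \<in> {0..T} \<Longrightarrow> (y has_vector_derivative F (?p (y t))) (at t within {0..T})"
    using ode_exists_Lipschitz[OF L(1) _ _ T(2), of "\<lambda>z. F (?p z)" x] T by auto
  have "continuous_on {0..T} y"
    by (rule continuous_on_vector_derivative) (rule y)
  then obtain d where d: "d > 0" "\<And>t. t \<in> {0..T} \<Longrightarrow> dist t 0 < d \<Longrightarrow> dist (y t) (y 0) < r"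
    using T r unfolding continuous_on_iff by (metis atLeastAtMost_iff less_imp_le order_refl)
  \<comment> \<open>Up to this time the solution has not left the ball, so the projection acts as
    the identity along it and the original equation holds.\<close>
  define T' where "T' = min T (d / 2)"
  have sub: "{0..T'} \<subseteq> {0..T}" and T': "0 < T'"
    using T d by (auto simp: T'_def)
  have ball: "y t \<in> cball x r" if "t \<in> {0..T'}" for t
  proof -
    have "dist (y t) (y 0) < r"
      using that sub d(1) by (intro d) (auto simp: T'_def)
    then show ?thesis
      using y(1) by (simp add: dist_commute)
  qed
  show thesis
  proof (rule that[of T' y, OF T' y(1)])
    fix t assume t: "t \<in> {0..T'}"
    have "(y has_vector_derivative F (?p (y t))) (at t within {0..T'})"
      using y(2) t sub by (blast intro: has_vector_derivative_within_subset)
    then show "y t \<in> V \<and> (y has_vector_derivative F (y t)) (at t within {0..T'})"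
      using ball[OF t] r(2) by (auto simp: closest_point_self)
  qed
qed

section \<open>From trajectories to identities for the derivative of \<Phi>\<close>

text \<open>Start at \<open>x\<close> with the constant input \<open>u\<close>. The derivative of
  \<open>\<Phi> (y t)\<close> at time \<open>0\<close> is given by the linear system on one side and
  by the chain rule on the other.\<close>

lemma transforms_to_linear_imp_fder:
  fixes f :: "real^'n \<Rightarrow> real^'n" and g :: "'m::finite \<Rightarrow> real^'n \<Rightarrow> real^'n" and B :: "real^'m^'n"
  assumes V: "open V" "V \<subseteq> X" "x \<in> V" and C: "C_inf_on V f" "\<And>i. C_inf_on V (g i)"
    and \<Phi>: "\<Phi> differentiable (at x)" and tr: "transforms_to_linear X f g V \<Phi> A B"
  shows "fder \<Phi> x (control_affine f g x u) = A *v \<Phi> x + B *v u"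
proof -
  have "C_on 1 V (\<lambda>z. control_affine f g z u)"
    unfolding control_affine_def
    using C by (intro C_on_add C_on_sum C_on_scaleR C_on_const V(1) finite) auto
  then obtain T y where T: "0 < T" and y: "y 0 = x"
    "\<And>t. t \<in> {0..T} \<Longrightarrow> y t \<in> V \<and>
      (y has_vector_derivative control_affine f g (y t) u) (at t within {0..T})"
    using ode_exists_C1[OF V(1,3)] by blast
  define J where "J = {t. 0 \<le> t \<and> ereal t < ereal T}"
  have J: "J \<subseteq> {0..T}" "0 \<in> J" "J = {0..<T}"
    using T by (auto simp: J_def)
  have dy: "(y has_vector_derivative control_affine f g (y t) u) (at t within J)" if "t \<in> J" for t
    using y(2)[of t] that J(1) has_vector_derivative_within_subset by blast
  then have "continuous_on J y"
    by (rule continuous_on_vector_derivative)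
  then have "solves_off {} J (control_affine f g) (\<lambda>_. u) y"
    using dy by (simp add: solves_off_def)
  moreover have yV: "y t \<in> V" if "t \<in> J" for t
    using y(2)[of t] that J(1) by blast
  \<comment> \<open>The trajectory stays in \<open>V\<close> during all of \<open>J\<close>, so the
    exit time is the infimum of the empty set and cuts nothing off.\<close>
  moreover have "{t \<in> J. ereal t < exit_time J V y} = J"
  proof -
    have "{\<tau> \<in> J. 0 < \<tau> \<and> y \<tau> \<notin> V} = {}"
      using yV by blast
    then have "exit_time J V y = \<infinity>"
      unfolding exit_time_def by (simp only: image_empty Inf_empty top_ereal_def)
    then show ?thesis
      by simp
  qed
  ultimately have "solves_off {} J (\<lambda>z w. A *v z + B *v w) (\<lambda>_. u) (\<lambda>t. \<Phi> (y t))"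
    using tr[unfolded transforms_to_linear_def Let_def, rule_format, of "{}" "ereal T" y "\<lambda>_. u"]
      y(1) V unfolding J_def[symmetric] by auto
  then have 1: "((\<lambda>t. \<Phi> (y t)) has_vector_derivative (A *v \<Phi> x + B *v u)) (at 0 within J)"
    using J(2) y(1) by (auto simp: solves_off_def)
  have "((\<lambda>t. \<Phi> (y t)) has_derivative (\<lambda>s. fder \<Phi> x (s *\<^sub>R control_affine f g x u))) (at 0 within J)"
    using has_derivative_compose[OF dy[OF J(2), unfolded has_vector_derivative_def], of \<Phi> "fder \<Phi> x"]
      has_derivative_fder[OF \<Phi>] y(1) by simp
  then have 2: "((\<lambda>t. \<Phi> (y t)) has_vector_derivative fder \<Phi> x (control_affine f g x u)) (at 0 within J)"
    by (simp add: has_vector_derivative_def linear_cmul[OF linear_fder[OF \<Phi>]])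
  \<comment> \<open>Time \<open>0\<close> is a limit point of the half-open interval
    \<open>J\<close>, which makes the one-sided derivative there unique.\<close>
  have "at 0 within J \<noteq> bot"
    unfolding J(3) using T by (simp add: trivial_limit_within islimpt_Ico)
  then show ?thesis
    using vector_derivative_unique_within[OF _ 2 1] by simp
qed

text \<open>The input \<open>0\<close> isolates the drift; subtracting it from the identity for the
  unit input \<open>axis i 1\<close> isolates the field \<open>g i\<close>.\<close>

lemma linearizable_on_fder:
  assumes V: "open V" "V \<subseteq> X" and C: "C_inf_on V f" "\<And>i. C_inf_on V (g i)"
    and "linearizable_on X f g V"
  obtains \<Phi> A B where "C2_diffeo_on V \<Phi>" "controllable A B"
    "\<And>x. x \<in> V \<Longrightarrow> fder \<Phi> x (f x) = A *v \<Phi> x"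
    "\<And>x i. x \<in> V \<Longrightarrow> fder \<Phi> x (g i x) = column i B"
proof -
  obtain \<Phi> A B where \<Phi>: "C2_diffeo_on V \<Phi>" and tr: "transforms_to_linear X f g V \<Phi> A B"
    and AB: "controllable A B"
    using assms(5) unfolding linearizable_on_def by blast
  have d: "\<Phi> differentiable (at x)" if "x \<in> V" for x
    using \<Phi> that by (auto simp: C2_diffeo_on_def numeral_2_eq_2)
  have id: "fder \<Phi> x (control_affine f g x u) = A *v \<Phi> x + B *v u" if "x \<in> V" for x u
    using transforms_to_linear_imp_fder[OF V that C d[OF that] tr] .
  have f: "fder \<Phi> x (f x) = A *v \<Phi> x" if "x \<in> V" for x
    using id[OF that, of 0] by (simp add: control_affine_def)
  have g: "fder \<Phi> x (g i x) = column i B" if "x \<in> V" for x i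
  proof -
    have "control_affine f g x (axis i 1) = f x + g i x"
      by (simp add: control_affine_def axis_def if_distrib[of "\<lambda>t. t *\<^sub>R _"] cong: if_cong)
    then show ?thesis
      using id[OF that, of "axis i 1"] f[OF that] linear_add[OF linear_fder[OF d[OF that]]]
      by (simp add: matrix_vector_mult_basis)
  qed
  show thesis
    by (rule that[OF \<Phi> AB f g])
qed

lemma linearizable_on_imp_conditions:
  assumes V: "open V" "V \<subseteq> X" and C: "C_inf_on V f" "\<And>i. C_inf_on V (g i)"
    and lin: "linearizable_on X f g V"
  shows "ad_rank_condition f g V \<and> ad_commute_condition f g V"
proof -
  obtain \<Phi> A B where *: "C2_diffeo_on V \<Phi>" "controllable A B"
    "\<And>x. x \<in> V \<Longrightarrow> fder \<Phi> x (f x) = A *v \<Phi> x"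
    "\<And>x i. x \<in> V \<Longrightarrow> fder \<Phi> x (g i x) = column i B"
    using linearizable_on_fder[OF V C lin] by blast
  show ?thesis
    using linear_coords_imp_conditions[OF V(1) *(1,2) C *(3,4)] by blast
qed

section \<open>Commuting frames and coordinates\<close>

lemma continuous_on_linear_family:
  fixes w :: "'a::topological_space \<Rightarrow> 'b::euclidean_space \<Rightarrow> 'c::real_normed_vector"
  assumes "\<And>y. y \<in> S \<Longrightarrow> linear (w y)" "\<And>d. continuous_on S (\<lambda>y. w y d)" "continuous_on S Y"
  shows "continuous_on S (\<lambda>y. w y (Y y))"
proof -
  have "continuous_on S (\<lambda>y. \<Sum>b\<in>Basis. (Y y \<bullet> b) *\<^sub>R w y b)"
    by (intro continuous_intros assms)
  moreover have "continuous_on S (\<lambda>y. w y (Y y)) \<longleftrightarrow> continuous_on S (\<lambda>y. \<Sum>b\<in>Basis. (Y y \<bullet> b) *\<^sub>R w y b)"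
    by (rule continuous_on_cong[OF refl]) (rule linear_family_expand[OF assms(1)])
  ultimately show ?thesis
    by blast
qed

text \<open>Closedness turns the derivative of the integrand of the radial integral into
  \<open>d/dt (t w(c + t (x - c)))\<close>.\<close>

lemma closed_form_exact_ball:
  fixes w :: "'a::euclidean_space \<Rightarrow> 'a \<Rightarrow> 'b::euclidean_space"
  assumes r: "r > 0" and lin: "\<And>x. x \<in> ball c r \<Longrightarrow> linear (w x)"
    and C: "\<And>d. C_on 1 (ball c r) (\<lambda>x. w x d)"
    and closed: "\<And>x d e. x \<in> ball c r \<Longrightarrow> fder (\<lambda>y. w y d) x e = fder (\<lambda>y. w y e) x d"
  obtains \<phi> where "\<phi> c = 0" "\<And>x. x \<in> ball c r \<Longrightarrow> (\<phi> has_derivative w x) (at x)"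
proof -
  let ?U = "ball c r" and ?I = "cbox 0 (1::real)"
  define p where "p x t = c + t *\<^sub>R (x - c)" for x and t :: real
  define D where "D x t e = t *\<^sub>R fder (\<lambda>y. w y e) (p x t) (x - c) + w (p x t) e" for x t e
  define \<phi> where "\<phi> x = integral ?I (\<lambda>t. w (p x t) (x - c))" for x
  have p: "p x t \<in> ?U" if "x \<in> ?U" "t \<in> ?I" for x t
  proof -
    have "\<bar>t\<bar> * norm (x - c) \<le> 1 * norm (x - c)"
      using that by (intro mult_right_mono) auto
    then show ?thesis
      using that(1) by (simp add: p_def dist_norm norm_minus_commute)
  qed
  have dw: "(\<lambda>y. w y d) differentiable (at x)" if "x \<in> ?U" for x d
    using C_on_SucD_differentiable[of 0 ?U "\<lambda>y. w y d" x] C that by simp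
  have cw: "continuous_on ?U (\<lambda>y. w y d)" "continuous_on ?U (\<lambda>y. fder (\<lambda>z. w z d) y e)" for d e
    using C_on_continuous_on[OF C] C[of d] by auto
  have dp: "((\<lambda>y. p y t) has_derivative (\<lambda>e. t *\<^sub>R e)) (at x)" for x t
    unfolding p_def by (auto intro!: derivative_eq_intros)
  have dpt: "(p x has_vector_derivative (x - c)) (at t within T)" for x t T
    unfolding p_def has_vector_derivative_def by (auto intro!: derivative_eq_intros)
  have wp: "((\<lambda>y. w (p y t) d) has_derivative (\<lambda>e. t *\<^sub>R fder (\<lambda>y. w y d) (p x t) e)) (at x)"
    if "x \<in> ?U" "t \<in> ?I" for x t d
    using has_derivative_compose[OF dp has_derivative_fder[OF dw[OF p[OF that]]]]
    by (simp add: linear_cmul[OF linear_fder[OF dw[OF p[OF that]]]])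
  have deriv: "((\<lambda>y. w (p y t) (y - c)) has_derivative D x t) (at x)" if "x \<in> ?U" "t \<in> ?I" for x t
  proof -
    have "((\<lambda>y. w (p y t) (y - c)) has_derivative
        (\<lambda>e. fder (\<lambda>y. w (p y t) (x - c)) x e + w (p x t) e)) (at x)"
    proof (rule has_derivative_linear_family[OF open_ball that(1), where Y="\<lambda>y. y - c" and Y'="\<lambda>e. e"])
      show "linear (w (p y t))" if "y \<in> ?U" for y
        using lin[OF p[OF that \<open>t \<in> ?I\<close>]] .
      show "(\<lambda>y. w (p y t) d) differentiable (at x)" for d
        using wp[OF that, of d] unfolding differentiable_def by blast
      show "((\<lambda>y. y - c) has_derivative (\<lambda>e. e)) (at x)"
        by (auto intro!: derivative_eq_intros)
    qed
    \<comment> \<open>Closedness enters here: it exchanges the direction \<open>e\<close> with the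
      radial direction \<open>x - c\<close>.\<close>
    moreover have "fder (\<lambda>y. w (p y t) (x - c)) x e = t *\<^sub>R fder (\<lambda>y. w y e) (p x t) (x - c)" for e
      using closed[OF p[OF that], of "x - c" e] by (simp add: fder_eqI[OF wp[OF that, of "x - c"]])
    ultimately show ?thesis
      by (simp only: D_def[abs_def])
  qed
  have bl: "bounded_linear (D x t)" if "x \<in> ?U" "t \<in> ?I" for x t
    using deriv[OF that] by (rule has_derivative_bounded_linear)
  have cp: "continuous_on (?U \<times> ?I) (\<lambda>z. p (fst z) (snd z))"
    unfolding p_def by (intro continuous_intros)
  have pz: "(\<lambda>z. p (fst z) (snd z)) ` (?U \<times> ?I) \<subseteq> ?U"
    using p by force
  have contD: "continuous_on (?U \<times> ?I) (\<lambda>z. D (fst z) (snd z) e)" for e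
  proof -
    have "continuous_on (?U \<times> ?I) (\<lambda>z. fder (\<lambda>y. w y e) (p (fst z) (snd z)) (fst z - c))"
    proof (rule continuous_on_linear_family[where w="\<lambda>z. fder (\<lambda>y. w y e) (p (fst z) (snd z))"
          and Y="\<lambda>z. fst z - c"])
      show "linear (fder (\<lambda>y. w y e) (p (fst z) (snd z)))" if "z \<in> ?U \<times> ?I" for z
        using that p by (intro linear_fder dw) auto
      show "continuous_on (?U \<times> ?I) (\<lambda>z. fder (\<lambda>y. w y e) (p (fst z) (snd z)) d)" for d
        by (rule continuous_on_compose2[OF cw(2) cp pz])
    qed (intro continuous_intros)
    moreover have "continuous_on (?U \<times> ?I) (\<lambda>z. w (p (fst z) (snd z)) e)"
      by (rule continuous_on_compose2[OF cw(1) cp pz])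
    ultimately show ?thesis
      unfolding D_def by (intro continuous_intros)
  qed
  \<comment> \<open>Differentiation under the integral needs a derivative that is continuous as an
    operator-valued map. In finite dimension this can be checked on each fixed vector, which is what
    \<open>contD\<close> provides.\<close>
  define DB where "DB x t = Blinfun (D x t)" for x t
  have DB: "blinfun_apply (DB x t) = D x t" if "x \<in> ?U" "t \<in> ?I" for x t
    unfolding DB_def using bl[OF that] by (rule bounded_linear_Blinfun_apply)
  have contDB: "continuous_on (?U \<times> ?I) (\<lambda>(x, t). DB x t)"
  proof (rule continuous_on_blinfun_componentwise)
    show "continuous_on (?U \<times> ?I) (\<lambda>z. blinfun_apply (case z of (x, t) \<Rightarrow> DB x t) e)" for e
      using contD[of e] by (rule continuous_on_eq) (auto simp: DB)
  qed
  have cont_t: "continuous_on ?I (\<lambda>t. w (p x t) d)" if "x \<in> ?U" for x d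
    by (rule continuous_on_compose2[OF cw(1)])
      (use p[OF that] in \<open>auto simp: p_def intro!: continuous_intros\<close>)
  have main: "(\<phi> has_derivative w x) (at x)" if x: "x \<in> ?U" for x
  proof -
    have "(\<phi> has_derivative blinfun_apply (integral ?I (DB x))) (at x within ?U)"
      unfolding \<phi>_def
    proof (rule leibniz_rule[OF _ _ contDB x convex_ball])
      show "((\<lambda>y. w (p y t) (y - c)) has_derivative blinfun_apply (DB y t)) (at y within ?U)"
        if "y \<in> ?U" "t \<in> ?I" for y t
        using deriv[OF that] by (simp add: DB[OF that] has_derivative_at_withinI)
      show "(\<lambda>t. w (p y t) (y - c)) integrable_on ?I" if "y \<in> ?U" for y
        using cont_t[OF that] by (rule integrable_continuous)
    qed
    moreover have "blinfun_apply (integral ?I (DB x)) e = w x e" for e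
    proof -
      have "continuous_on ?I (\<lambda>t. DB x t)"
      proof -
        have "continuous_on ?I (\<lambda>t. (x, t))"
          by (intro continuous_on_Pair continuous_on_const continuous_on_id)
        moreover have "(\<lambda>t. (x, t)) ` ?I \<subseteq> ?U \<times> ?I"
          using x by auto
        ultimately show ?thesis
          using continuous_on_compose2[OF contDB, of ?I "\<lambda>t. (x, t)"] by simp
      qed
      then have int: "DB x integrable_on ?I"
        by (rule integrable_continuous)
      have "blinfun_apply (integral ?I (DB x)) e = integral ?I (\<lambda>t. blinfun_apply (DB x t) e)"
        using integral_linear[OF int bounded_bilinear.bounded_linear_left[OF bounded_bilinear_blinfun_apply], of e]
        by (simp add: o_def)
      also have "\<dots> = integral ?I (\<lambda>t. D x t e)"
        by (rule Henstock_Kurzweil_Integration.integral_cong) (simp add: DB[OF x])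
      \<comment> \<open>Boundary values of \<open>t *\<^sub>R w (p x t) e\<close>: the factor
        \<open>t\<close> kills the one at the centre, and \<open>p x 1\<close> is
        \<open>x\<close>.\<close>
      also have "\<dots> = 1 *\<^sub>R w (p x 1) e - 0 *\<^sub>R w (p x 0) e"
        unfolding cbox_interval
      proof (rule integral_unique, rule fundamental_theorem_of_calculus)
        fix t :: real assume t: "t \<in> {0..1}"
        have dw': "((\<lambda>y. w y e) has_derivative fder (\<lambda>y. w y e) (p x t)) (at (p x t))"
          using p[OF x] t by (intro has_derivative_fder dw) auto
        have "((\<lambda>t. w (p x t) e) has_derivative (\<lambda>s. s *\<^sub>R fder (\<lambda>y. w y e) (p x t) (x - c))) (at t within {0..1})"
          using has_derivative_compose[OF dpt[unfolded has_vector_derivative_def] dw']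
            linear_cmul[OF has_derivative_linear[OF dw']] by simp
        then show "((\<lambda>t. t *\<^sub>R w (p x t) e) has_vector_derivative D x t e) (at t within {0..1})"
          unfolding D_def has_vector_derivative_def
          by (auto intro!: derivative_eq_intros simp: algebra_simps)
      qed simp
      finally show ?thesis
        by (simp add: p_def)
    qed
    moreover from this have "blinfun_apply (integral ?I (DB x)) = w x"
      by (rule ext)
    ultimately have "(\<phi> has_derivative w x) (at x within ?U)"
      by (simp only:)
    then show ?thesis
      using at_within_open[OF x open_ball] by simp
  qed
  have "c \<in> ?U"
    using r by simp
  then have "\<phi> c = 0"
    using linear_0[OF lin] by (simp add: \<phi>_def p_def)
  with main show thesis
    by (rule that[rotated])
qed

section \<open>Differentiable dependence of the inverse matrix\<close>

lemma C_on_det: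
  fixes M :: "'a::euclidean_space \<Rightarrow> real^'n^'n"
  assumes "open S" "\<And>i j. C_on k S (\<lambda>x. M x $ i $ j)"
  shows "C_on k S (\<lambda>x. det (M x))"
  unfolding det_def
  by (intro C_on_sum C_on_mult C_on_const C_on_prod assms finite finite_permutations)

lemma matrix_inv_works:
  fixes M :: "real^'n^'n"
  assumes "det M \<noteq> 0"
  shows "matrix_inv M *v (M *v c) = c" "M *v (matrix_inv M *v c) = c"
proof -
  have "M ** matrix_inv M = mat 1 \<and> matrix_inv M ** M = mat 1"
    unfolding matrix_inv_def by (rule someI_ex) (use assms in \<open>simp flip: invertible_det_nz invertible_def\<close>)
  then show "matrix_inv M *v (M *v c) = c" "M *v (matrix_inv M *v c) = c"
    by (simp_all add: matrix_vector_mul_assoc)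
qed

text \<open>By Cramer's rule each component of the solution is a quotient of determinants, that is,
  of polynomials in the entries.\<close>

lemma C_on_matrix_inv:
  fixes M :: "'a::euclidean_space \<Rightarrow> real^'n^'n"
  assumes S: "open S" and M: "\<And>i j. C_on k S (\<lambda>x. M x $ i $ j)"
    and det: "\<And>x. x \<in> S \<Longrightarrow> det (M x) \<noteq> 0"
  shows "C_on k S (\<lambda>x. matrix_inv (M x) *v d)"
proof -
  \<comment> \<open>The Cramer numerator: column \<open>l\<close> of \<open>M x\<close> is replaced
    by \<open>d\<close>.\<close>
  define N where "N l x = det (\<chi> i j. if j = l then d $ i else M x $ i $ j)" for l x
  have "C_on k S (N l)" for l
    unfolding N_def
  proof (rule C_on_det[OF S])
    show "C_on k S (\<lambda>x. (\<chi> i j. if j = l then d $ i else M x $ i $ j) $ i $ j)" for i j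
      using M C_on_const by (cases "j = l") auto
  qed
  then have "C_on k S (\<lambda>x. \<chi> l. N l x * inverse (det (M x)))"
    by (intro C_on_vec_lambda C_on_mult C_on_inverse C_on_det S M det)
  moreover have "matrix_inv (M x) *v d = (\<chi> l. N l x * inverse (det (M x)))" if "x \<in> S" for x
    using cramer[OF det[OF that], of "matrix_inv (M x) *v d" d] matrix_inv_works(2)[OF det[OF that]]
    by (simp add: N_def divide_inverse)
  ultimately show ?thesis
    using C_on_cong[OF S, of "\<lambda>x. matrix_inv (M x) *v d" "\<lambda>x. \<chi> l. N l x * inverse (det (M x))" k]
    by simp
qed

text \<open>The one-forms dual to a commuting frame are closed, so they are the differentials of
  coordinates in which the frame becomes the standard one. No flows are needed.\<close>

lemma commuting_frame_coordinates:
  fixes Y :: "'n::finite \<Rightarrow> real^'n \<Rightarrow> real^'n"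
  assumes r: "r > 0" and Y: "\<And>j. C_on 1 (ball c r) (Y j)"
    and det: "\<And>x. x \<in> ball c r \<Longrightarrow> det (\<chi> i j. Y j x $ i) \<noteq> 0"
    and comm: "\<And>i j x. x \<in> ball c r \<Longrightarrow> lie_bracket (Y i) (Y j) x = 0"
  obtains \<Phi> :: "real^'n \<Rightarrow> real^'n" where "\<Phi> c = 0" "C_on 2 (ball c r) \<Phi>"
    "\<And>x j. x \<in> ball c r \<Longrightarrow> fder \<Phi> x (Y j x) = axis j 1"
proof -
  let ?S = "ball c r"
  define M where "M x = (\<chi> i j. Y j x $ i)" for x
  \<comment> \<open>The columns of \<open>M x\<close> are the frame, so component \<open>j\<close>
    of \<open>w x d\<close> is the coefficient of \<open>d\<close> along \<open>Y j x\<close>: the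
    dual one-forms, bundled into one vector-valued form.\<close>
  define w where "w x d = matrix_inv (M x) *v d" for x d
  have detM: "det (M x) \<noteq> 0" if "x \<in> ?S" for x
    using det[OF that] by (simp add: M_def)
  have MY: "M x *v axis j 1 = Y j x" for x j
    by (simp add: matrix_vector_mult_basis M_def column_def vec_eq_iff)
  have lin: "linear (w x)" for x
    unfolding w_def by (rule matrix_vector_mul_linear)
  have Cw: "C_on 1 ?S (\<lambda>x. w x d)" for d
    unfolding w_def
  proof (rule C_on_matrix_inv[OF open_ball _ detM])
    show "C_on 1 ?S (\<lambda>x. M x $ i $ j)" for i j
      using C_on_vec_nth[OF open_ball Y[of j], of i] by (simp only: M_def vec_lambda_beta)
  qed
  have dw: "(\<lambda>y. w y d) differentiable (at x)" if "x \<in> ?S" for x d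
    using C_on_SucD_differentiable[of 0 ?S "\<lambda>y. w y d" x] Cw that by simp
  have dY: "Y j differentiable (at x)" if "x \<in> ?S" for x j
    using C_on_SucD_differentiable[of 0 ?S "Y j" x] Y that by simp
  have wY: "w x (Y j x) = axis j 1" if "x \<in> ?S" for x j
    using matrix_inv_works(1)[OF detM[OF that], of "axis j 1"] by (simp add: w_def MY)
  have repr: "d = (\<Sum>j\<in>UNIV. w x d $ j *\<^sub>R Y j x)" if "x \<in> ?S" for x d
  proof -
    have "d = M x *v w x d"
      using matrix_inv_works(2)[OF detM[OF that]] by (simp add: w_def)
    also have "\<dots> = (\<Sum>j\<in>UNIV. w x d $ j *\<^sub>R Y j x)"
      by (simp add: matrix_mult_sum scalar_mult_eq_scaleR M_def column_def vec_lambda_eta)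
    finally show ?thesis .
  qed
  \<comment> \<open>Obtained by differentiating the constant pairing
    \<open>w y (Y j y) = axis j 1\<close>.\<close>
  have fderw: "fder (\<lambda>y. w y (Y j x)) x e = - w x (fder (Y j) x e)" if x: "x \<in> ?S" for x j e
  proof -
    have "fder (\<lambda>y. w y (Y j y)) x e = 0"
      using fder_cong_const[OF open_ball x wY] by simp
    then show ?thesis
      using differentiable_linear_family(2)[OF open_ball x lin dw[OF x] dY[OF x], of j e]
      by (simp add: eq_neg_iff_add_eq_0)
  qed
  have fderw_sum: "fder (\<lambda>y. w y (\<Sum>j\<in>UNIV. a j *\<^sub>R Y j x)) x e
      = (\<Sum>j\<in>UNIV. a j *\<^sub>R fder (\<lambda>y. w y (Y j x)) x e)" if x: "x \<in> ?S" for x a e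
  proof -
    have "((\<lambda>y. \<Sum>j\<in>UNIV. a j *\<^sub>R w y (Y j x)) has_derivative
        (\<lambda>e. \<Sum>j\<in>UNIV. a j *\<^sub>R fder (\<lambda>y. w y (Y j x)) x e)) (at x)"
      by (intro has_derivative_sum has_derivative_scaleR_right has_derivative_fder dw x)
    then show ?thesis
      by (simp add: linear_sum[OF lin] linear_cmul[OF lin] fder_eqI)
  qed
  \<comment> \<open>Expanding both directions in the frame expresses the derivative of
    \<open>w\<close> through \<open>fder (Y j) x (Y k x)\<close> alone. Symmetry of these vectors in
    \<open>j\<close> and \<open>k\<close> is precisely the vanishing of the brackets.\<close>
  have key: "fder (\<lambda>y. w y d) x e
      = - (\<Sum>j\<in>UNIV. \<Sum>k\<in>UNIV. (w x d $ j * w x e $ k) *\<^sub>R w x (fder (Y j) x (Y k x)))"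
    if x: "x \<in> ?S" for x d e
  proof -
    have "fder (\<lambda>y. w y d) x e = fder (\<lambda>y. w y (\<Sum>j\<in>UNIV. w x d $ j *\<^sub>R Y j x)) x e"
      using repr[OF x, of d] by simp
    also have "\<dots> = (\<Sum>j\<in>UNIV. w x d $ j *\<^sub>R - w x (fder (Y j) x e))"
      by (simp add: fderw_sum[OF x] fderw[OF x])
    also have "\<dots> = (\<Sum>j\<in>UNIV. w x d $ j *\<^sub>R
        - w x (fder (Y j) x (\<Sum>k\<in>UNIV. w x e $ k *\<^sub>R Y k x)))"
      using repr[OF x, of e] by simp
    also have "\<dots> = (\<Sum>j\<in>UNIV. w x d $ j *\<^sub>R
        - (\<Sum>k\<in>UNIV. w x e $ k *\<^sub>R w x (fder (Y j) x (Y k x))))"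
      by (simp only: linear_sum[OF linear_fder[OF dY[OF x]]] linear_cmul[OF linear_fder[OF dY[OF x]]]
          linear_sum[OF lin] linear_cmul[OF lin])
    finally show ?thesis
      by (simp add: scaleR_sum_right sum_negf)
  qed
  have closed: "fder (\<lambda>y. w y d) x e = fder (\<lambda>y. w y e) x d" if x: "x \<in> ?S" for x d e
  proof -
    have sym: "fder (Y j) x (Y k x) = fder (Y k) x (Y j x)" for j k
      using comm[OF x, of j k] by (simp add: lie_bracket_eq dY[OF x])
    have "(\<Sum>j\<in>UNIV. \<Sum>k\<in>UNIV. (w x d $ j * w x e $ k) *\<^sub>R w x (fder (Y j) x (Y k x)))
      = (\<Sum>j\<in>UNIV. \<Sum>k\<in>UNIV. (w x e $ j * w x d $ k) *\<^sub>R w x (fder (Y j) x (Y k x)))"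
      by (subst sum.swap, intro sum.cong refl, subst sym) (simp add: mult.commute)
    then show ?thesis
      by (simp only: key[OF x])
  qed
  obtain \<Phi> where \<Phi>: "\<Phi> c = 0" "\<And>x. x \<in> ?S \<Longrightarrow> (\<Phi> has_derivative w x) (at x)"
    using closed_form_exact_ball[OF r lin Cw closed] by blast
  show thesis
  proof (rule that[of \<Phi>])
    show "\<Phi> c = 0" by (rule \<Phi>)
    show "C_on 2 ?S \<Phi>"
      unfolding numeral_2_eq_2 by (rule C_on_SucI[OF open_ball \<Phi>(2)]) (use Cw in simp_all)
    show "fder \<Phi> x (Y j x) = axis j 1" if "x \<in> ?S" for x j
      using fder_eqI[OF \<Phi>(2)[OF that]] wY[OF that] by simp
  qed
qed

section \<open>Frame coordinates as a local diffeomorphism\<close>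

text \<open>Summation against the frame is a linear right inverse of \<open>D\<close>; for linear
  endomorphisms in finite dimension a right inverse is also a left inverse.\<close>

lemma frame_coordinates_expand:
  fixes Y :: "'n::finite \<Rightarrow> real^'n" and D :: "real^'n \<Rightarrow> real^'n"
  assumes lin: "linear D" and D: "\<And>j. D (Y j) = axis j 1"
  shows "(\<Sum>j\<in>UNIV. D d $ j *\<^sub>R Y j) = d" "D (\<Sum>j\<in>UNIV. c $ j *\<^sub>R Y j) = c" "inj D"
proof -
  let ?E = "\<lambda>c. \<Sum>j\<in>UNIV. c $ j *\<^sub>R Y j"
  have 1: "D (?E c) = c" for c
    using basis_expansion[of c] by (simp add: linear_sum[OF lin] linear_cmul[OF lin] D scalar_mult_eq_scaleR)
  have "linear ?E"
    by (rule linearI) (simp_all add: sum.distrib scaleR_add_left scaleR_sum_right)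
  then have "?E \<circ> D = id"
    using linear_inverse_left[OF lin, of ?E] 1 by (simp add: fun_eq_iff)
  then show 2: "?E (D d) = d" for d
    by (simp add: fun_eq_iff)
  show "D (?E c) = c" by (rule 1)
  show "inj D"
    using 2 by (rule inj_on_inverseI)
qed

text \<open>The inverse function theorem gives a differentiable local inverse \<open>h\<close>. Its
  derivative is the frame evaluated along \<open>h\<close>, and this formula upgrades
  \<open>h\<close> to class \<open>C_on 2\<close>.\<close>

lemma frame_coordinates_local_diffeo:
  fixes Y :: "'n::finite \<Rightarrow> real^'n \<Rightarrow> real^'n" and \<Phi> :: "real^'n \<Rightarrow> real^'n"
  assumes S: "open S" "x0 \<in> S" and \<Phi>: "C_on 2 S \<Phi>" and Y: "\<And>j. C_on 1 S (Y j)"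
    and \<Phi>Y: "\<And>x j. x \<in> S \<Longrightarrow> fder \<Phi> x (Y j x) = axis j 1"
  obtains U where "open U" "x0 \<in> U" "U \<subseteq> S" "C2_diffeo_on U \<Phi>"
proof -
  have d\<Phi>: "\<Phi> differentiable (at x)" if "x \<in> S" for x
    using \<Phi> that by (auto simp: numeral_2_eq_2)
  note ex = frame_coordinates_expand[OF linear_fder[OF d\<Phi>] \<Phi>Y]
  define D where "D x = Blinfun (fder \<Phi> x)" for x
  have D: "blinfun_apply (D x) = fder \<Phi> x" if "x \<in> S" for x
    unfolding D_def
    by (intro bounded_linear_Blinfun_apply has_derivative_bounded_linear[OF has_derivative_fder[OF d\<Phi>[OF that]]])
  have contD: "continuous_on S D"
  proof (rule continuous_on_blinfun_componentwise)
    fix e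
    have "continuous_on S (\<lambda>x. fder \<Phi> x e)"
      using \<Phi> C_on_continuous_on[OF C_on_SucD_fder[of 1 S \<Phi> e]] by (simp add: numeral_2_eq_2)
    then show "continuous_on S (\<lambda>x. blinfun_apply (D x) e)"
      by (rule continuous_on_eq) (simp add: D)
  qed
  define E where "E = Blinfun (\<lambda>c. \<Sum>j\<in>UNIV. c $ j *\<^sub>R Y j x0)"
  have "bounded_linear (\<lambda>c. \<Sum>j\<in>UNIV. c $ j *\<^sub>R Y j x0)"
    by (intro bounded_linear_sum bounded_linear_scaleR_const bounded_linear_vec_nth)
  then have E: "blinfun_apply E = (\<lambda>c. \<Sum>j\<in>UNIV. c $ j *\<^sub>R Y j x0)"
    unfolding E_def by (rule bounded_linear_Blinfun_apply)
  \<comment> \<open>Summation against the frame at \<open>x0\<close> supplies the inverse that the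
    inverse function theorem asks for.\<close>
  have "E o\<^sub>L D x0 = id_blinfun"
    by (rule blinfun_eqI) (simp add: E D[OF S(2)] ex(1)[OF S(2) S(2)])
  then obtain U V h h' where U: "open U" "U \<subseteq> S" "x0 \<in> U" and V: "open V" and hom: "homeomorphism U V \<Phi> h"
    and h: "\<And>y. y \<in> V \<Longrightarrow> (h has_derivative h' y) (at y)"
      "\<And>y. y \<in> V \<Longrightarrow> h' y = inv (blinfun_apply (D (h y)))"
    using inverse_function_theorem[OF S(1) _ contD S(2), of \<Phi> E] has_derivative_fder[OF d\<Phi>] D
    by (metis (no_types, lifting))
  have hU: "h y \<in> U" "h y \<in> S" if "y \<in> V" for y
    using hom that U(2) by (auto simp: homeomorphism_def)
  have h'eq: "h' y = (\<lambda>c. \<Sum>j\<in>UNIV. c $ j *\<^sub>R Y j (h y))" if "y \<in> V" for y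
  proof -
    note hy = hU(2)[OF that]
    have "inv (fder \<Phi> (h y)) = (\<lambda>c. \<Sum>j\<in>UNIV. c $ j *\<^sub>R Y j (h y))"
      by (rule inv_equality) (use ex(1)[OF hy hy] ex(2)[OF hy hy] in auto)
    then show ?thesis
      using h(2)[OF that] D[OF hy] by simp
  qed
  have hder: "(h has_derivative (\<lambda>c. \<Sum>j\<in>UNIV. c $ j *\<^sub>R Y j (h y))) (at y)" if "y \<in> V" for y
    using h(1)[OF that] h'eq[OF that] by simp
  \<comment> \<open>Bootstrapping: the derivative of \<open>h\<close> is built from the compositions
    of the \<open>Y j\<close> with \<open>h\<close>, so each order of \<open>h\<close> yields the
    next. The bound on \<open>k\<close> matches the regularity of the frame.\<close>
  have step: "C_on (Suc k) V h" if "C_on k V h" "k \<le> 1" for k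
  proof (rule C_on_SucI[OF V hder])
    have "C_on k V (\<lambda>y. Y j (h y))" for j
      by (rule C_on_compose[OF V C_on_mono[OF Y \<open>k \<le> 1\<close>] that(1)]) (use hU in auto)
    then show "C_on k V (\<lambda>y. \<Sum>j\<in>UNIV. c $ j *\<^sub>R Y j (h y))" for c
      by (intro C_on_sum[OF V] C_on_scaleR[OF V] C_on_const finite)
  qed
  have "C_on 0 V h"
    using hom by (simp add: homeomorphism_def)
  then have "C_on 2 V h"
    using step[of 0] step[of 1] by (simp add: numeral_2_eq_2 del: C_on.simps)
  have inj: "inj_on \<Phi> U" and im: "\<Phi> ` U = V"
    using hom by (auto simp: homeomorphism_def intro: inj_on_inverseI)
  have "inv_into U \<Phi> y = h y" if "y \<in> V" for y
    using hom hU(1)[OF that] inv_into_f_f[OF inj, of "h y"] that by (simp add: homeomorphism_def)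
  then have "C_on 2 V (inv_into U \<Phi>)"
    using C_on_cong[OF V, of "inv_into U \<Phi>" h 2] \<open>C_on 2 V h\<close> by simp
  then have "C2_diffeo_on U \<Phi>"
    using C_on_subset[OF \<Phi> U(2)] inj im V by (simp add: C2_diffeo_on_def)
  then show thesis
    using U that by blast
qed

section \<open>Sufficiency\<close>

text \<open>By linearity, the identities for the drift and for the input fields combine into one for
  every input value. The chain rule then applies at each time before the exit time that is outside
  \<open>N\<close>.\<close>

lemma fder_imp_transforms_to_linear:
  fixes f :: "real^'n \<Rightarrow> real^'n" and g :: "'m::finite \<Rightarrow> real^'n \<Rightarrow> real^'n"
  assumes d: "\<And>x. x \<in> V \<Longrightarrow> \<Phi> differentiable (at x)"
    and f: "\<And>x. x \<in> V \<Longrightarrow> fder \<Phi> x (f x) = A *v \<Phi> x"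
    and g: "\<And>x i. x \<in> V \<Longrightarrow> fder \<Phi> x (g i x) = column i B"
  shows "transforms_to_linear X f g V \<Phi> A B"
proof -
  have id: "fder \<Phi> x (control_affine f g x u) = A *v \<Phi> x + B *v u" if x: "x \<in> V" for x u
  proof -
    note lin = linear_fder[OF d[OF x]]
    have "fder \<Phi> x (control_affine f g x u) = A *v \<Phi> x + (\<Sum>i\<in>UNIV. u $ i *\<^sub>R column i B)"
      by (simp add: control_affine_def linear_add[OF lin] linear_sum[OF lin] linear_cmul[OF lin] f g x)
    then show ?thesis
      by (simp add: matrix_mult_sum scalar_mult_eq_scaleR)
  qed
  show ?thesis
    unfolding transforms_to_linear_def Let_def
  proof (intro allI impI)
    fix u :: "real \<Rightarrow> real^'m" and x :: "real \<Rightarrow> real^'n" and T :: ereal and N :: "real set"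
    define J where "J = {t. 0 \<le> t \<and> ereal t < T}"
    define J' where "J' = {t \<in> J. ereal t < exit_time J V x}"
    assume "x 0 \<in> V" and sol: "solves_off N {t. 0 \<le> t \<and> ereal t < T} (control_affine f g) u x"
    have sol': "continuous_on J x"
      "\<And>t. t \<in> J - N \<Longrightarrow> (x has_vector_derivative control_affine f g (x t) (u t)) (at t within J)"
      using sol by (auto simp: solves_off_def J_def)
    have J': "J' \<subseteq> J"
      by (auto simp: J'_def)
    \<comment> \<open>A time in \<open>J\<close> at which the trajectory is outside \<open>V\<close>
      bounds the exit time from above. It is positive because the trajectory starts in
      \<open>V\<close>, and the exit time only counts positive times.\<close>
    have xV: "x t \<in> V" if "t \<in> J'" for t
    proof (rule ccontr)
      assume "x t \<notin> V"
      moreover from this have "t \<noteq> 0"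
        using \<open>x 0 \<in> V\<close> by metis
      ultimately have "exit_time J V x \<le> ereal t"
        using that unfolding exit_time_def J'_def J_def by (intro Inf_lower imageI) auto
      then show False
        using that by (auto simp: J'_def)
    qed
    have "continuous_on V \<Phi>"
      using d by (auto simp: continuous_on_eq_continuous_within
          intro: differentiable_imp_continuous_within differentiable_at_withinI)
    then have "continuous_on J' (\<lambda>t. \<Phi> (x t))"
      by (rule continuous_on_compose2) (use sol'(1) J' xV in \<open>auto intro: continuous_on_subset\<close>)
    moreover have "((\<lambda>t. \<Phi> (x t)) has_vector_derivative A *v \<Phi> (x t) + B *v u t) (at t within J')"
      if t: "t \<in> J' - N" for t
    proof -
      have xt: "x t \<in> V"
        using xV t by blast
      have "(x has_vector_derivative control_affine f g (x t) (u t)) (at t within J')"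
        using sol'(2) t J' has_vector_derivative_within_subset by blast
      then have "((\<lambda>t. \<Phi> (x t)) has_derivative
          (\<lambda>s. fder \<Phi> (x t) (s *\<^sub>R control_affine f g (x t) (u t)))) (at t within J')"
        unfolding has_vector_derivative_def
        by (rule has_derivative_compose[where f=x and g=\<Phi>, OF _ has_derivative_fder[OF d[OF xt]]])
      then show ?thesis
        by (simp add: has_vector_derivative_def linear_cmul[OF linear_fder[OF d[OF xt]]] id[OF xt])
    qed
    ultimately show "solves_off N
        {t \<in> {t. 0 \<le> t \<and> ereal t < T}. ereal t < exit_time {t. 0 \<le> t \<and> ereal t < T} V x}
        (\<lambda>z w. A *v z + B *v w) u (\<lambda>t. \<Phi> (x t))"
      unfolding solves_off_def J_def[symmetric] J'_def[symmetric] by blast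
  qed
qed

text \<open>The image of \<open>W\<close> is the preimage of \<open>W\<close> under the continuous
  inverse, hence open, and on it the two choices of \<open>inv_into\<close> agree.\<close>

lemma C2_diffeo_on_subset:
  assumes V: "open V" "open W" "W \<subseteq> V" and \<Phi>: "C2_diffeo_on V \<Phi>"
  shows "C2_diffeo_on W \<Phi>"
proof -
  let ?\<Psi> = "inv_into V \<Phi>"
  have inj: "inj_on \<Phi> V" "inj_on \<Phi> W" and op: "open (\<Phi> ` V)" and C: "C_on 2 V \<Phi>" "C_on 2 (\<Phi> ` V) ?\<Psi>"
    using \<Phi> V by (auto simp: C2_diffeo_on_def intro: inj_on_subset)
  have "\<Phi> ` W = ?\<Psi> -` W \<inter> \<Phi> ` V"
    using inj(1) V(3) by (force simp: inv_into_f_f)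
  moreover have "open (?\<Psi> -` W \<inter> \<Phi> ` V)"
    using C_on_continuous_on[OF C(2)] op V(2) continuous_on_open_vimage by blast
  ultimately have opW: "open (\<Phi> ` W)"
    by simp
  have "C_on 2 (\<Phi> ` W) ?\<Psi>"
    using C(2) V(3) by (rule C_on_subset[OF _ image_mono])
  moreover have "inv_into W \<Phi> y = ?\<Psi> y" if "y \<in> \<Phi> ` W" for y
    using that inj V(3) by (auto simp: inv_into_f_f subset_iff)
  ultimately have "C_on 2 (\<Phi> ` W) (inv_into W \<Phi>)"
    using C_on_cong[OF opW, of "inv_into W \<Phi>" ?\<Psi> 2] by simp
  then show ?thesis
    using C_on_subset[OF C(1) V(3)] inj opW by (simp add: C2_diffeo_on_def)
qed

lemma linearizable_onI:
  assumes "C2_diffeo_on V \<Phi>" "controllable A B"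
    and "\<And>x. x \<in> V \<Longrightarrow> fder \<Phi> x (f x) = A *v \<Phi> x"
    and "\<And>x i. x \<in> V \<Longrightarrow> fder \<Phi> x (g i x) = column i B"
  shows "linearizable_on X f g V"
proof -
  have "\<Phi> differentiable (at x)" if "x \<in> V" for x
    using assms(1) that by (auto simp: C2_diffeo_on_def numeral_2_eq_2)
  then have "transforms_to_linear X f g V \<Phi> A B"
    by (rule fder_imp_transforms_to_linear) (use assms in auto)
  then show ?thesis
    using assms(1,2) unfolding linearizable_on_def by blast
qed

text \<open>The identities for the derivative of \<Phi> are pointwise and so restrict to
  \<open>W\<close> at once; they are then turned back into a statement about trajectories.\<close>

lemma linearizable_on_subset:
  assumes V: "open V" "V \<subseteq> X" and C: "C_inf_on V f" "\<And>i. C_inf_on V (g i)"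
    and lin: "linearizable_on X f g V" and W: "open W" "W \<subseteq> V"
  shows "linearizable_on X f g W"
proof -
  obtain \<Phi> A B where *: "C2_diffeo_on V \<Phi>" "controllable A B"
    "\<And>x. x \<in> V \<Longrightarrow> fder \<Phi> x (f x) = A *v \<Phi> x"
    "\<And>x i. x \<in> V \<Longrightarrow> fder \<Phi> x (g i x) = column i B"
    using linearizable_on_fder[OF V C lin] by blast
  show ?thesis
    by (rule linearizable_onI[OF C2_diffeo_on_subset[OF V(1) W *(1)] *(2)]) (use * W in auto)
qed

lemma fder_eq_0_on_ball_imp_const:
  fixes h :: "'a::euclidean_space \<Rightarrow> 'b::real_normed_vector"
  assumes "r > 0" "\<And>x. x \<in> ball c r \<Longrightarrow> h differentiable (at x)"
    and "\<And>x d. x \<in> ball c r \<Longrightarrow> fder h x d = 0" and "x \<in> ball c r"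
  shows "h x = h c"
proof -
  have "(h has_derivative (\<lambda>d. 0)) (at y within ball c r)" if "y \<in> ball c r" for y
  proof -
    have "fder h y = (\<lambda>d. 0)"
      using assms(3)[OF that] by (rule ext)
    then show ?thesis
      using has_derivative_at_withinI[OF has_derivative_fder[OF assms(2)[OF that]]] by simp
  qed
  then obtain k where "\<And>y. y \<in> ball c r \<Longrightarrow> h y = k"
    using has_derivative_zero_constant[OF convex_ball] by blast
  then show ?thesis
    using assms(1,4) by simp
qed

section \<open>Choice of the frame and construction of the linear system\<close>

text \<open>Among the vectors spanning at \<open>x0\<close> there is a basis, which can be indexed
  by the type \<open>'n\<close> itself. The determinant of the corresponding fields is continuous
  and nonzero at \<open>x0\<close>, hence nonzero on a ball.\<close>

lemma ad_conditions_frame: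
  fixes f :: "real^'n \<Rightarrow> real^'n" and g :: "'m::finite \<Rightarrow> real^'n \<Rightarrow> real^'n"
  assumes V: "open V" "x0 \<in> V" and C: "C_inf_on V f" "\<And>i. C_inf_on V (g i)"
    and rank: "ad_rank_condition f g V"
  obtains s :: "'n \<Rightarrow> 'm" and k :: "'n \<Rightarrow> nat" and r where "r > 0" "ball x0 r \<subseteq> V"
    "\<And>x. x \<in> ball x0 r \<Longrightarrow> det (\<chi> i j. lie_ad f (k j) (g (s j)) x $ i) \<noteq> 0"
proof -
  let ?S = "{lie_ad f j (g i) x0 | i j. j \<le> CARD('n) - 1}"
  obtain B where B: "B \<subseteq> ?S" "independent B" "?S \<subseteq> span B" "card B = dim ?S"
    using basis_exists by blast
  have cardB: "card B = CARD('n)"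
    using B(4) rank V(2) by (simp add: ad_rank_condition_def dim_span)
  then have "finite B"
    using card_gt_0_iff[of B] by simp
  then obtain b :: "'n \<Rightarrow> real^'n" where b: "bij_betw b UNIV B"
    using finite_same_card_bij[OF finite, of B UNIV] cardB by auto
  have "\<exists>i j. b l = lie_ad f j (g i) x0" for l
  proof -
    have "b l \<in> ?S"
      using bij_betwE[OF b] B(1) by auto
    then show ?thesis
      by auto
  qed
  then obtain s k where sk: "\<And>l. b l = lie_ad f (k l) (g (s l)) x0"
    by metis
  define M where "M x = (\<chi> i j. lie_ad f (k j) (g (s j)) x $ i)" for x
  have "columns (M x0) = B"
  proof -
    have "column l (M x0) = b l" for l
      by (simp add: M_def column_def sk vec_eq_iff)
    then show ?thesis
      using b by (auto simp: columns_def bij_betw_def)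
  qed
  then have "rank (M x0) = CARD('n)"
    using cardB dim_eq_card_independent[OF B(2)] by (simp add: column_rank_def)
  then have "det (M x0) \<noteq> 0"
    using det_eq_0_rank[of "M x0"] by simp
  moreover have cont: "continuous_on V (\<lambda>x. det (M x))"
  proof (rule C_on_continuous_on[OF C_on_det[OF V(1)]])
    show "C_on 0 V (\<lambda>x. M x $ i $ j)" for i j
      using C_on_vec_nth[OF V(1) C_inf_on_lie_ad[OF V(1) C, rule_format], of 0 "k j" "s j" i]
      by (simp only: M_def vec_lambda_beta)
  qed
  moreover have "open (V \<inter> (\<lambda>x. det (M x)) -` (- {0}))"
    using cont by (rule continuous_open_preimage[OF _ V(1)]) auto
  ultimately have "\<exists>r>0. ball x0 r \<subseteq> V \<inter> (\<lambda>x. det (M x)) -` (- {0})"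
    using V(2) unfolding open_contains_ball by simp
  then obtain r where r: "r > 0" "ball x0 r \<subseteq> V \<inter> (\<lambda>x. det (M x)) -` (- {0})"
    by (elim exE conjE)
  show thesis
  proof (rule that[of r k s])
    show "ball x0 r \<subseteq> V" "r > 0"
      using r by auto
    show "det (\<chi> i j. lie_ad f (k j) (g (s j)) x $ i) \<noteq> 0" if "x \<in> ball x0 r" for x
      using subsetD[OF r(2) that] by (simp add: M_def)
  qed
qed

text \<open>The set \<open>U\<close> results from shrinking \<open>V\<close> twice: to a ball on
  which the chosen frame stays independent, and then to a neighbourhood on which the inverse
  function theorem makes \<Phi> a diffeomorphism.\<close>

lemma ad_conditions_imp_linearizable_on:
  fixes f :: "real^'n \<Rightarrow> real^'n" and g :: "'m::finite \<Rightarrow> real^'n \<Rightarrow> real^'n"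
  assumes V: "open V" "x0 \<in> V" and C: "C_inf_on V f" "\<And>i. C_inf_on V (g i)" and f0: "f x0 = 0"
    and rank: "ad_rank_condition f g V" and comm: "ad_commute_condition f g V"
  obtains U where "open U" "x0 \<in> U" "U \<subseteq> V" "linearizable_on X f g U"
proof -
  obtain s :: "'n \<Rightarrow> 'm" and k r where r: "r > 0" "ball x0 r \<subseteq> V"
    and det: "\<And>x. x \<in> ball x0 r \<Longrightarrow> det (\<chi> i j. lie_ad f (k j) (g (s j)) x $ i) \<noteq> 0"
    by (rule ad_conditions_frame[OF V C rank]) (rule that)
  let ?S = "ball x0 r"
  define Y where "Y j = lie_ad f (k j) (g (s j))" for j
  have Cad: "C_inf_on ?S (lie_ad f l (g i))" for l i
    by (intro allI) (rule C_on_subset[OF C_inf_on_lie_ad[OF V(1) C, rule_format] r(2)])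
  have Cf: "C_inf_on ?S f"
    by (intro allI) (rule C_on_subset[OF C(1)[rule_format] r(2)])
  have dad: "lie_ad f l (g i) differentiable (at x)" if "x \<in> ?S" for l i x
    using C_inf_onD[OF Cad that] .
  have df: "f differentiable (at x)" if "x \<in> ?S" for x
    using C_inf_onD[OF Cf that] .
  have CY: "C_on 1 ?S (Y j)" for j
    unfolding Y_def by (rule Cad[rule_format])
  have brY: "lie_bracket (Y i) (Y j) x = 0" if "x \<in> ?S" for i j x
    using comm r(2) that unfolding Y_def ad_commute_condition_def by blast
  have det': "det (\<chi> i j. Y j x $ i) \<noteq> 0" if "x \<in> ?S" for x
    unfolding Y_def by (rule det[OF that])
  obtain \<Phi> :: "real^'n \<Rightarrow> real^'n" where \<Phi>0: "\<Phi> x0 = 0" and \<Phi>: "C_on 2 ?S \<Phi>"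
    and \<Phi>Y: "\<And>x j. x \<in> ?S \<Longrightarrow> fder \<Phi> x (Y j x) = axis j 1"
    using commuting_frame_coordinates[OF r(1) CY det' brY] by auto
  have d\<Phi>: "\<Phi> differentiable (at x)" "(\<lambda>y. fder \<Phi> y e) differentiable (at x)" if "x \<in> ?S" for x e
    using \<Phi> that by (auto simp: numeral_2_eq_2)
  have lin: "linear (fder \<Phi> x)" if "x \<in> ?S" for x
    using linear_fder[OF d\<Phi>(1)[OF that]] .
  note ex = frame_coordinates_expand[OF lin \<Phi>Y]
  have d\<Phi>Z: "(\<lambda>y. fder \<Phi> y (Z y)) differentiable (at x)" if "x \<in> ?S" "Z differentiable (at x)" for x Z
    by (rule differentiable_linear_family(1)[OF open_ball that(1) lin d\<Phi>(2)[OF that(1)] that(2)])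
  \<comment> \<open>The image of \<open>Y j\<close> is constant, so only one of the two terms of the
    bracket formula survives.\<close>
  have along_Y: "fder (\<lambda>y. fder \<Phi> y (Z y)) x (Y j x) = fder \<Phi> x (lie_bracket Z (Y j) x)"
    if x: "x \<in> ?S" and Z: "Z differentiable (at x)" for x Z j
  proof -
    have "Y j differentiable (at x)"
      unfolding Y_def by (rule dad[OF x])
    then show ?thesis
      using fder_lie_bracket[OF open_ball x \<Phi> Z] fder_cong_const[OF open_ball x \<Phi>Y] by simp
  qed
  have expand: "h d = (\<Sum>j\<in>UNIV. fder \<Phi> x d $ j *\<^sub>R h (Y j x))" if "x \<in> ?S" "linear h"
    for x d and h :: "real^'n \<Rightarrow> real^'n"
  proof -
    have "h d = h (\<Sum>j\<in>UNIV. fder \<Phi> x d $ j *\<^sub>R Y j x)"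
      using ex(1)[OF that(1) that(1)] by simp
    then show ?thesis
      by (simp only: linear_sum[OF that(2)] linear_cmul[OF that(2)])
  qed
  \<comment> \<open>The bracket with every frame field vanishes, so the derivative is zero along a
    basis of directions at each point of the ball.\<close>
  have const: "fder \<Phi> x (lie_ad f l (g i) x) = fder \<Phi> x0 (lie_ad f l (g i) x0)" if "x \<in> ?S" for l i x
  proof (rule fder_eq_0_on_ball_imp_const[OF r(1) _ _ that])
    fix y assume y: "y \<in> ?S"
    show D: "(\<lambda>y. fder \<Phi> y (lie_ad f l (g i) y)) differentiable (at y)"
      by (rule d\<Phi>Z[OF y dad[OF y]])
    have "lie_bracket (lie_ad f l (g i)) (Y j) y = 0" for j
      using comm r(2) y unfolding Y_def ad_commute_condition_def by blast
    then show "fder (\<lambda>y. fder \<Phi> y (lie_ad f l (g i) y)) y d = 0" for d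
      using expand[OF y linear_fder[OF D], of d] linear_0[OF lin[OF y]]
      by (simp add: along_Y[OF y dad[OF y]])
  qed
  \<comment> \<open>Column \<open>j\<close> is the image at \<open>x0\<close> of the bracket of
    \<open>f\<close> with \<open>Y j\<close>; as \<open>Y j\<close> is already a bracket of order
    \<open>k j\<close>, this has order \<open>Suc (k j)\<close>. It is the slope of
    \<open>fder \<Phi> y (f y)\<close> along \<open>Y j\<close>.\<close>
  define A :: "real^'n^'n" where "A = (\<chi> i j. fder \<Phi> x0 (lie_ad f (Suc (k j)) (g (s j)) x0) $ i)"
  define B :: "real^'m^'n" where "B = (\<chi> l i. fder \<Phi> x0 (g i x0) $ l)"
  have colA: "A *v c = (\<Sum>j\<in>UNIV. c $ j *\<^sub>R fder \<Phi> x0 (lie_ad f (Suc (k j)) (g (s j)) x0))" for c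
    by (simp add: matrix_mult_sum scalar_mult_eq_scaleR A_def column_def vec_lambda_eta)
  have g: "fder \<Phi> x (g i x) = column i B" if "x \<in> ?S" for x i
    using const[OF that, of 0 i] by (simp add: B_def column_def vec_lambda_eta)
  have f: "fder \<Phi> x (f x) = A *v \<Phi> x" if "x \<in> ?S" for x
  proof -
    let ?h = "\<lambda>y. fder \<Phi> y (f y) - A *v \<Phi> y"
    \<comment> \<open>Both terms of \<open>?h\<close> have the same derivative along the frame, so
      \<open>?h\<close> is constant. Its value at \<open>x0\<close> is zero because
      \<open>f x0\<close> and \<open>\<Phi> x0\<close> both vanish.\<close>
    have "?h x = ?h x0"
    proof (rule fder_eq_0_on_ball_imp_const[OF r(1) _ _ that])
      fix y assume y: "y \<in> ?S"
      note D = d\<Phi>Z[OF y df[OF y]]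
      have "(?h has_derivative (\<lambda>d. fder (\<lambda>y. fder \<Phi> y (f y)) y d - A *v fder \<Phi> y d)) (at y)"
        by (intro has_derivative_diff has_derivative_fder[OF D]
            bounded_linear.has_derivative[OF matrix_vector_mul_bounded_linear]
            has_derivative_fder[OF d\<Phi>(1)[OF y]])
      moreover have "fder (\<lambda>y. fder \<Phi> y (f y)) y d = A *v fder \<Phi> y d" for d
      proof -
        have "lie_bracket f (Y j) = lie_ad f (Suc (k j)) (g (s j))" for j
          by (simp add: Y_def)
        then have "fder (\<lambda>y. fder \<Phi> y (f y)) y (Y j y)
            = fder \<Phi> x0 (lie_ad f (Suc (k j)) (g (s j)) x0)" for j
          using along_Y[OF y df[OF y], of j] const[OF y, of "Suc (k j)" "s j"] by simp
        then show ?thesis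
          using expand[OF y linear_fder[OF D], of d] by (simp only: colA)
      qed
      ultimately have "(?h has_derivative (\<lambda>d. 0)) (at y)"
        by simp
      then show "?h differentiable (at y)" "fder ?h y d = 0" for d
        using fder_eqI[of ?h "\<lambda>d. 0" y] by (auto simp: differentiable_def)
    qed
    then show ?thesis
      using r(1) linear_0[OF lin] by (simp add: f0 \<Phi>0)
  qed
  have x0: "x0 \<in> ?S"
    using r(1) by simp
  obtain U where U: "open U" "x0 \<in> U" "U \<subseteq> ?S" "C2_diffeo_on U \<Phi>"
    using frame_coordinates_local_diffeo[OF open_ball x0 \<Phi> CY \<Phi>Y] by auto
  \<comment> \<open>With the two identities established, controllability of the constructed pair can
    be read off from the rank condition at the single point \<open>x0\<close>.\<close>
  have ad: "fder \<Phi> x0 (lie_ad f l (g i) x0) = mat_pow A l *v column i B" for i l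
    by (rule fder_lie_ad[OF open_ball \<Phi> Cf _ f g x0]) (use Cad[of 0] in auto)
  then have "controllable A B"
    using controllable_iff_dim_span_lie_ad[OF ad lin[OF x0] ex(3)[OF x0 x0]] rank V(2)
    unfolding ad_rank_condition_def by simp
  then have "linearizable_on X f g U"
    by (rule linearizable_onI[OF U(4)]) (use f g U(3) in auto)
  then show thesis
    using U r(2) by (intro that[of U]) auto
qed

section \<open>Equivalence of linearizability and the two conditions near the equilibrium\<close>

text \<open>Necessity holds on every neighbourhood, whereas the construction for sufficiency may
  shrink the set. Equivalence on the same set is therefore asserted for all sufficiently small
  neighbourhoods, next to the equivalence of existence and to necessity on each set.\<close>

theorem corollary1:
  fixes X :: "(real^'n) set"
    and f :: "real^'n \<Rightarrow> real^'n"
    and g :: "'m::finite \<Rightarrow> real^'n \<Rightarrow> real^'n"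
    and x0 :: "real^'n"
  assumes "smooth_on X f"
    and "\<And>i. smooth_on X (g i)"
    and "x0 \<in> X"
    and "f x0 = 0"
  shows "((\<exists>V. nbhd_in X x0 V \<and> linearizable_on X f g V) \<longleftrightarrow>
          (\<exists>V. nbhd_in X x0 V \<and> ad_rank_condition f g V \<and> ad_commute_condition f g V))
       \<and> (\<forall>V. nbhd_in X x0 V \<and> linearizable_on X f g V \<longrightarrow>
            ad_rank_condition f g V \<and> ad_commute_condition f g V)
       \<and> (\<exists>U. open U \<and> x0 \<in> U \<and>
            (\<forall>V. nbhd_in X x0 V \<and> V \<subseteq> U \<longrightarrow>
              (linearizable_on X f g V \<longleftrightarrow>
               ad_rank_condition f g V \<and> ad_commute_condition f g V)))"
proof -
  have C: "C_inf_on V f" "\<And>i. C_inf_on V (g i)" if "nbhd_in X x0 V" for V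
    using smooth_on_imp_C_inf_on[OF assms(1), of V] smooth_on_imp_C_inf_on[OF assms(2), of V] that
    unfolding nbhd_in_def by auto
  have nec: "ad_rank_condition f g V \<and> ad_commute_condition f g V"
    if "nbhd_in X x0 V" "linearizable_on X f g V" for V
    using linearizable_on_imp_conditions[OF _ _ C[OF that(1)] that(2)] that(1)
    by (simp add: nbhd_in_def)
  have suf: "\<exists>U. nbhd_in X x0 U \<and> linearizable_on X f g U"
    if V: "nbhd_in X x0 V" and ad: "ad_rank_condition f g V" "ad_commute_condition f g V" for V
  proof -
    obtain U where "open U" "x0 \<in> U" "U \<subseteq> V" "linearizable_on X f g U"
      using ad_conditions_imp_linearizable_on[OF _ _ C[OF V] assms(4) ad] V
      unfolding nbhd_in_def by blast
    then show ?thesis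
      using V unfolding nbhd_in_def by blast
  qed
  have "\<exists>U. open U \<and> x0 \<in> U \<and> (\<forall>V. nbhd_in X x0 V \<and> V \<subseteq> U \<longrightarrow>
      (linearizable_on X f g V \<longleftrightarrow> ad_rank_condition f g V \<and> ad_commute_condition f g V))"
  proof (cases "\<exists>U. nbhd_in X x0 U \<and> linearizable_on X f g U")
    case True
    then obtain U where U: "nbhd_in X x0 U" and lin: "linearizable_on X f g U"
      by blast
    \<comment> \<open>Inside one linearizable neighbourhood both sides of the equivalence are true:
      linearizability restricts to \<open>V\<close>, and necessity gives the conditions.\<close>
    have "linearizable_on X f g V" if "nbhd_in X x0 V" "V \<subseteq> U" for V
      using linearizable_on_subset[OF _ _ C[OF U] lin _ that(2)] U that(1)
      by (simp add: nbhd_in_def)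
    then show ?thesis
      using U nec unfolding nbhd_in_def by (intro exI[of _ U]) blast
  next
    case False
    \<comment> \<open>Here both sides are false for every \<open>V\<close>: the conditions on any
      neighbourhood would produce a linearizable one by \<open>suf\<close>. Hence the whole space
      serves as \<open>U\<close>.\<close>
    then show ?thesis
      using suf by (intro exI[of _ UNIV]) auto
  qed
  then show ?thesis
    using nec suf by blast
qed

end
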